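(* Let $n\ge 1$ and let $U=U(q,p)(\lambda)$ be any one of the following seven matrices (with $g,\delta,\epsilon$ scalar parameters): $$\begin{pmatrix} -\lambda+p & -e^{-q}\\ e^{q} & 0\end{pmatrix},\quad \begin{pmatrix} -\lambda+p & -e^{-q}\\ p\,e^{q} & -1\end{pmatrix},\quad \begin{pmatrix} \frac1\lambda-\lambda e^{p} & -e^{-q}\\ e^{q} & -\lambda\end{pmatrix},\quad \begin{pmatrix} \frac1\lambda-\lambda e^{p} & -g^2e^{-q+p}\\ e^{q} & 0\end{pmatrix},$$ $$\begin{pmatrix} \frac1\lambda-\lambda e^{p} & -g^2(e^{p}+\delta)e^{-q}\\ e^{q} & -\lambda\delta g^2\end{pmatrix},\quad \begin{pmatrix} \frac1\lambda-\lambda e^{\epsilon p} & -\epsilon e^{-q}\\ \epsilon e^{q} & -\epsilon^2\lambda\end{pmatrix},\quad \begin{pmatrix} \frac1\lambda-\lambda e^{\epsilon p} & -(e^{\epsilon p}-1)e^{-q}\\ \epsilon e^{q} & \lambda\epsilon\end{pmatrix}.$$ Let $\chi_n(\lambda)=\mathrm{tr}\big(U^n(\lambda)\cdots U^1(\lambda)\big)$ and $\tilde\chi_n(\lambda)=\mathrm{tr}\big(E_{11}U^n(\lambda)\cdots U^1(\lambda)\big)$, where $U^k(\lambda)=U(q^k,p_k)(\lambda)$. Then $$\chi_n(\lambda)\ast\chi_n(\mu)=\chi_n(\mu)\ast\chi_n(\lambda),\qquad \tilde\chi_n(\lambda)\ast\tilde\chi_n(\mu)=\tilde\chi_n(\mu)\ast\tilde\chi_n(\lambda),$$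 where $\ast$ is the Weyl-type star product on $\mathbb{R}^{2n}$ and $\lambda,\mu$ are independent spectral parameters. Hence every star polynomial $H$ of the coefficients (with respect to $\lambda$) of $\chi_n(\lambda)$, respectively of $\tilde\chi_n(\lambda)$, defines a quantum integrable system, in the sense that these coefficients commute pairwise with respect to $\ast$ and each of them commutes with $H$ with respect to $\ast$. In particular, the nonperiodic and the periodic Toda chains, with Hamiltonians $$H_{\rm np}=\frac12\sum_{i=1}^n p_i^2+\sum_{i=1}^{n-1}e^{q^i-q^{i+1}},\qquad H_{\rm per}=H_{\rm np}+e^{q^n-q^1},$$ are quantum integrable: for $H=H_{\rm np}$ (respectively $H=H_{\rm per}$) there exist $n$ formal power series $F_1,\dots,F_n\in C^\infty(\mathbb{R}^{2n})[[\hbar]]$ which coincide at order $\hbar^0$ with the classical conserved quantities $f_1,\dots,f_n$ and satisfy $F_i\ast H-H\ast F_i=0$ and $F_i\ast F_j-F_j\ast F_i=0$ for all $1\le i,j\le n$; here $f_1,\dots,f_n$ are the $n$ nonconstant coefficients (those of $\lambda^0,\dots,\lambda^{n-1}$) of $\tilde\chi_n(\lambda)$ (respectively $\chi_n(\lambda)$) formed with the first of the seven matrices $U$.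
   Context: Coordinates on $\mathbb{R}^{2n}$ are $(\vec q,\vec p)=(q^1,\dots,q^n,p_1,\dots,p_n)$. Functions are complex-valued and smooth, $\hbar$ is a formal parameter, and $\rho:=i\hbar/2$. The star product of Weyl type is $$(F\ast G)(\vec q,\vec p)=\exp\Big(\frac{i\hbar}{2}\sum_{j=1}^n\Big(\frac{\partial^2}{\partial q^j\partial p'_j}-\frac{\partial^2}{\partial q'^j\partial p_j}\Big)\Big)F(\vec q,\vec p)\,G(\vec q\,',\vec p\,')\Big|_{\vec q=\vec q\,',\ \vec p=\vec p\,'},$$ extended linearly over $\mathbb{C}[[\hbar]]$ and over rational functions of the spectral parameters $\lambda,\mu$. It is associative. $E_{ij}$ are the standard $2\times2$ matrix units. In the definitions of $\chi_n$ and $\tilde\chi_n$ the products of matrices use pointwise multiplication of functions (matrices with different upper indices depend on different pairs of variables, so using $\ast$ instead would give the same result). The upper index $k$ in $U^k$ is a label (the $k$-th particle), not a power. The functions $\chi_n,\tilde\chi_n$ are Laurent polynomials in $\lambda$ with coefficients in $C^\infty(\mathbb{R}^{2n})$. A star polynomial of given functions is a polynomial expression in them in which all products are taken with respect to $\ast$. General definition: a classical completely integrable system with Hamilton function $H$ on a $2n$-dimensional symplectic manifold $M$ is quantum integrable if there are a star product $\ast$ and $n$ formal power series $F_i\in C^\infty(M)[[\hbar]]$, coinciding with the classical conserved quantities $f_i$ at order zero in $\hbar$, such that $F_i\ast H-H\ast F_i=0$ and $F_i\ast F_j-F_j\ast F_i=0$ for all $1\le i,j\le n$. *)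

theory Defs
  imports
    "HOL-Analysis.Analysis"
    "HOL-Computational_Algebra.Formal_Power_Series"
    "HOL-Library.Poly_Mapping"
    "HOL-Library.Function_Algebras"
begin

text \<open>
  The phase space of \<open>n = CARD('n)\<close> particles is \<open>\<real>\<^sup>n \<times> \<real>\<^sup>n\<close>, with points \<open>(q, p)\<close>. Functions on it form a
  commutative ring under the pointwise operations (\<open>Function_Algebras\<close>), so that
  \<open>'n obs fps\<close> consists of formal power series in the deformation parameter \<open>\<hbar>\<close> and
  \<open>int \<Rightarrow>\<^sub>0 'n obs\<close> (with the convolution product of \<open>Poly_Mapping\<close>) is the ring of Laurent
  polynomials in one spectral parameter with functions as coefficients.
\<close>

type_synonym 'n phase = "(real ^ 'n) \<times> (real ^ 'n)"
type_synonym 'n obs = "'n phase \<Rightarrow> complex"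
type_synonym 'n laurent = "int \<Rightarrow>\<^sub>0 'n obs"

definition dir_deriv :: "'a::real_normed_vector \<Rightarrow> ('a \<Rightarrow> 'b::real_normed_vector) \<Rightarrow> 'a \<Rightarrow> 'b" where
  "dir_deriv v f x = vector_derivative (\<lambda>t. f (x + t *\<^sub>R v)) (at 0)"

text \<open>
  A function is \<open>C\<^sup>\<infinity>\<close> iff all its iterated partial derivatives (of any order, including \<open>0\<close>) are
  differentiable everywhere: being differentiable, each of them is continuous and its own partial
  derivatives exist.
\<close>

definition smooth :: "('a::euclidean_space \<Rightarrow> 'b::real_normed_vector) \<Rightarrow> bool" where
  "smooth f \<longleftrightarrow> (\<forall>vs. set vs \<subseteq> Basis \<longrightarrow> (\<forall>x. foldr dir_deriv vs f differentiable (at x)))"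

definition smooth_fps :: "'n::finite obs fps \<Rightarrow> bool" where
  "smooth_fps F \<longleftrightarrow> (\<forall>k. smooth (fps_nth F k))"


section \<open>The star product of Weyl type\<close>

text \<open>
  The operator \<open>\<Sum>\<^sub>j (\<partial>\<^sup>2/\<partial>q\<^sup>j\<partial>p'\<^sub>j - \<partial>\<^sup>2/\<partial>q'\<^sup>j\<partial>p\<^sub>j)\<close> on functions of \<open>((q, p), (q', p'))\<close>.
\<close>

definition weyl_op :: "('n::finite phase \<times> 'n phase \<Rightarrow> complex) \<Rightarrow> 'n phase \<times> 'n phase \<Rightarrow> complex" where
  "weyl_op K = (\<lambda>x. \<Sum>j\<in>UNIV.
       dir_deriv ((axis j 1, 0), (0, 0)) (dir_deriv ((0, 0), (0, axis j 1)) K) x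
     - dir_deriv ((0, 0), (axis j 1, 0)) (dir_deriv ((0, axis j 1), (0, 0)) K) x)"

text \<open>The coefficient of \<open>\<hbar>\<^sup>k\<close> in the star product of two functions.\<close>

definition weyl_coeff :: "nat \<Rightarrow> 'n::finite obs \<Rightarrow> 'n obs \<Rightarrow> 'n obs" where
  "weyl_coeff k F G =
     (\<lambda>x. (\<i> / 2) ^ k / fact k * (weyl_op ^^ k) (\<lambda>(y, y'). F y * G y') (x, x))"

text \<open>The \<open>\<complex>[[\<hbar>]]\<close>-bilinear extension to formal power series with functions as coefficients.\<close>

definition star :: "'n::finite obs fps \<Rightarrow> 'n obs fps \<Rightarrow> 'n obs fps" (infixl "\<star>" 70) where
  "F \<star> G = Abs_fps (\<lambda>m. \<Sum>k\<le>m. \<Sum>a\<le>m - k. weyl_coeff k (fps_nth F a) (fps_nth G (m - k - a)))"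

text \<open>
  The extension to Laurent polynomials in the spectral parameters. With exponents \<open>'k = int \<times> int\<close>,
  these are the Laurent polynomials in two independent parameters \<open>\<lambda>, \<mu>\<close>.
\<close>

definition star_laurent ::
    "('k::plus \<Rightarrow>\<^sub>0 'n::finite obs fps) \<Rightarrow> ('k \<Rightarrow>\<^sub>0 'n obs fps) \<Rightarrow> ('k \<Rightarrow>\<^sub>0 'n obs fps)" (infixl "\<star>\<^sub>L" 70) where
  "X \<star>\<^sub>L Y = (\<Sum>a\<in>Poly_Mapping.keys X. \<Sum>b\<in>Poly_Mapping.keys Y.
     Poly_Mapping.single (a + b) (Poly_Mapping.lookup X a \<star> Poly_Mapping.lookup Y b))"

definition at_lambda :: "'n::finite laurent \<Rightarrow> (int \<times> int) \<Rightarrow>\<^sub>0 'n obs fps" where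
  "at_lambda X = (\<Sum>a\<in>Poly_Mapping.keys X.
     Poly_Mapping.single (a, 0) (fps_const (Poly_Mapping.lookup X a)))"

definition at_mu :: "'n::finite laurent \<Rightarrow> (int \<times> int) \<Rightarrow>\<^sub>0 'n obs fps" where
  "at_mu X = (\<Sum>a\<in>Poly_Mapping.keys X.
     Poly_Mapping.single (0, a) (fps_const (Poly_Mapping.lookup X a)))"

inductive_set star_polynomials :: "'n::finite obs set \<Rightarrow> 'n obs fps set" for A where
  generator: "f \<in> A \<Longrightarrow> fps_const f \<in> star_polynomials A"
| scalar: "Abs_fps (\<lambda>k. \<lambda>_. fps_nth c k) \<in> star_polynomials A" for c :: "complex fps"
| add: "F \<in> star_polynomials A \<Longrightarrow> G \<in> star_polynomials A \<Longrightarrow> F + G \<in> star_polynomials A"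
| star: "F \<in> star_polynomials A \<Longrightarrow> G \<in> star_polynomials A \<Longrightarrow> F \<star> G \<in> star_polynomials A"


section \<open>The matrices U and the functions built from them\<close>

definition lam :: "'n laurent" where
  "lam = Poly_Mapping.single 1 1"

definition lam_inv :: "'n laurent" where
  "lam_inv = Poly_Mapping.single (- 1) 1"

definition emb :: "'n obs \<Rightarrow> 'n laurent" where
  "emb f = Poly_Mapping.single 0 f"

definition con :: "complex \<Rightarrow> 'n obs" where
  "con c = (\<lambda>_. c)"

definition expf :: "'n obs \<Rightarrow> 'n obs" where
  "expf f = (\<lambda>x. exp (f x))"

definition mat2 :: "'a::zero \<Rightarrow> 'a \<Rightarrow> 'a \<Rightarrow> 'a \<Rightarrow> 'a ^ 2 ^ 2" where
  "mat2 a b c d = vector [vector [a, b], vector [c, d]]"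

type_synonym 'n lax = "'n obs \<Rightarrow> 'n obs \<Rightarrow> 'n laurent ^ 2 ^ 2"

definition lax1 :: "'n lax" where
  "lax1 q p = mat2 (- lam + emb p)  (- emb (expf (- q)))
                   (emb (expf q))   0"

definition lax2 :: "'n lax" where
  "lax2 q p = mat2 (- lam + emb p)      (- emb (expf (- q)))
                   (emb (p * expf q))   (- 1)"

definition lax3 :: "'n lax" where
  "lax3 q p = mat2 (lam_inv - lam * emb (expf p))  (- emb (expf (- q)))
                   (emb (expf q))                  (- lam)"

definition lax4 :: "complex \<Rightarrow> 'n lax" where
  "lax4 g q p = mat2 (lam_inv - lam * emb (expf p))  (- emb (con (g\<^sup>2) * expf (- q + p)))
                     (emb (expf q))                  0"

definition lax5 :: "complex \<Rightarrow> complex \<Rightarrow> 'n lax" where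
  "lax5 g \<delta> q p =
     mat2 (lam_inv - lam * emb (expf p))  (- emb (con (g\<^sup>2) * (expf p + con \<delta>) * expf (- q)))
          (emb (expf q))                  (- lam * emb (con (\<delta> * g\<^sup>2)))"

definition lax6 :: "complex \<Rightarrow> 'n lax" where
  "lax6 \<epsilon> q p =
     mat2 (lam_inv - lam * emb (expf (con \<epsilon> * p)))  (- emb (con \<epsilon> * expf (- q)))
          (emb (con \<epsilon> * expf q))                    (- emb (con (\<epsilon>\<^sup>2)) * lam)"

definition lax7 :: "complex \<Rightarrow> 'n lax" where
  "lax7 \<epsilon> q p =
     mat2 (lam_inv - lam * emb (expf (con \<epsilon> * p)))  (- emb ((expf (con \<epsilon> * p) - 1) * expf (- q)))
          (emb (con \<epsilon> * expf q))                    (lam * emb (con \<epsilon>))"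

definition q_coord :: "'n::finite \<Rightarrow> 'n obs" where
  "q_coord j = (\<lambda>x. complex_of_real (fst x $ j))"

definition p_coord :: "'n::finite \<Rightarrow> 'n obs" where
  "p_coord j = (\<lambda>x. complex_of_real (snd x $ j))"

text \<open>
  Particles are numbered \<open>1, \<dots>, n\<close> by a map \<open>e :: nat \<Rightarrow> 'n\<close> (a bijection from \<open>{1..n}\<close>).
  The product \<open>U\<^sup>k \<cdots> U\<^sup>1\<close>:
\<close>

primrec monodromy :: "'n::finite lax \<Rightarrow> (nat \<Rightarrow> 'n) \<Rightarrow> nat \<Rightarrow> 'n laurent ^ 2 ^ 2" where
  "monodromy U e 0 = mat 1"
| "monodromy U e (Suc k) =
     U (q_coord (e (Suc k))) (p_coord (e (Suc k))) ** monodromy U e k"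

definition chi :: "'n::finite lax \<Rightarrow> (nat \<Rightarrow> 'n) \<Rightarrow> nat \<Rightarrow> 'n laurent" where
  "chi U e n = trace (monodromy U e n)"

definition chi_tilde :: "'n::finite lax \<Rightarrow> (nat \<Rightarrow> 'n) \<Rightarrow> nat \<Rightarrow> 'n laurent" where
  "chi_tilde U e n = trace (mat2 1 0 0 0 ** monodromy U e n)"

definition coeffs_of :: "'n laurent \<Rightarrow> 'n obs set" where
  "coeffs_of X = range (Poly_Mapping.lookup X)"


section \<open>Quantum integrability and the Toda chains\<close>

text \<open>
  Quantum integrability, with respect to the Weyl-type star product, of the system with Hamilton
  function \<open>H\<close> and classical conserved quantities \<open>f 1, \<dots>, f n\<close>.
\<close>

definition quantum_integrable :: "nat \<Rightarrow> 'n::finite obs \<Rightarrow> (nat \<Rightarrow> 'n obs) \<Rightarrow> bool" where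
  "quantum_integrable n H f \<longleftrightarrow>
     (\<exists>F :: nat \<Rightarrow> 'n obs fps.
        (\<forall>i\<in>{1..n}. smooth_fps (F i) \<and> fps_nth (F i) 0 = f i) \<and>
        (\<forall>i\<in>{1..n}. F i \<star> fps_const H - fps_const H \<star> F i = 0) \<and>
        (\<forall>i\<in>{1..n}. \<forall>j\<in>{1..n}. F i \<star> F j - F j \<star> F i = 0))"

definition toda_np :: "(nat \<Rightarrow> 'n::finite) \<Rightarrow> nat \<Rightarrow> 'n obs" where
  "toda_np e n = (\<lambda>x. 1 / 2 * (\<Sum>i=1..n. (p_coord (e i) x)\<^sup>2)
     + (\<Sum>i\<in>{1..<n}. exp (q_coord (e i) x - q_coord (e (i + 1)) x)))"

definition toda_per :: "(nat \<Rightarrow> 'n::finite) \<Rightarrow> nat \<Rightarrow> 'n obs" where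
  "toda_per e n = (\<lambda>x. toda_np e n x + exp (q_coord (e n) x - q_coord (e 1) x))"

end

theory Submission
  imports Defs
begin

text \<open>
  Both statements reduce to the pairwise commutativity of the coefficients of \<open>\<chi>\<^sub>n\<close> and \<open>\<chi>~\<^sub>n\<close>.
  Evaluated at numbers \<open>\<lambda>\<close> and \<open>\<mu>\<close> with \<open>\<lambda>\<^sup>2 \<noteq> \<mu>\<^sup>2\<close>, each of the seven matrices satisfies an RTT relation
  \<open>R U\<^sub>1(\<lambda>) U\<^sub>2(\<mu>) = U\<^sub>2(\<mu>) U\<^sub>1(\<lambda>) R\<close> over the star algebra, where \<open>R\<close> is an invertible six-vertex matrix with
  scalar entries, rational for the first two matrices and trigonometric for the other five. Entries at
  different sites star-commute and their star product is pointwise, so the relation passes to the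
  monodromy matrix. Its trace gives the commutation of \<open>\<chi>\<^sub>n(\<lambda>)\<close> and \<open>\<chi>\<^sub>n(\<mu>)\<close>, and its (11,11) component
  that of \<open>\<chi>~\<^sub>n(\<lambda>)\<close> and \<open>\<chi>~\<^sub>n(\<mu>)\<close>; the coefficients are recovered because a Laurent polynomial with
  infinitely many zeros vanishes. With \<open>P\<close> the total momentum, both Toda Hamiltonians are
  \<open>P \<star> P / 2 - (-1)\<^sup>n c\<close> up to a constant, where \<open>c\<close> is the coefficient of \<open>\<lambda>\<^bsup>n-2\<^esup>\<close>, and \<open>P\<close> is itself,
  up to sign, the coefficient of \<open>\<lambda>\<^bsup>n-1\<^esup>\<close>.
\<close>

subsection \<open>Polynomials in linear forms and their exponentials\<close>

text \<open>The formula for \<open>\<star>\<close> makes sense for arbitrary functions, but its ring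
  laws need derivatives that behave. Hence all work takes place in one class of functions that is
  closed under derivatives, sums, products and linear substitutions and contains every matrix entry.
  On this class the star product becomes the multiplication of a ring type, and the RTT relations
  turn into ordinary noncommutative algebra. Numerical spectral parameters put the entries of R into
  \<complex>[[\<hbar>]], where a nonzero constant term already gives an inverse. At \<hbar> = 0 each
  R is a multiple of the identity, by \<lambda> - \<mu> in the rational and by \<lambda>/\<mu> -
  \<mu>/\<lambda> in the trigonometric case; this is the origin of the condition on the squares. The
  deformation enters through \<eta> = \<i>\<hbar>, the star commutator of q and p, and through v =
  exp(-\<i>\<hbar>b), the factor gained when exp(b p) is moved past exp(q). The Toda Hamiltonians
  need no quantum correction, because P is free of the positions and so P \<star> P is the pointwise
  square.\<close>

lemma dir_deriv_eq:
  assumes "(f has_derivative f') (at x)"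
  shows "dir_deriv v f x = f' v"
proof -
  have "((\<lambda>t. x + t *\<^sub>R v) has_derivative (\<lambda>t. t *\<^sub>R v)) (at (0::real))"
    by (auto intro!: derivative_eq_intros)
  then have "((\<lambda>t. f (x + t *\<^sub>R v)) has_derivative (\<lambda>t. f' (t *\<^sub>R v))) (at 0)"
    by (rule has_derivative_compose) (simp add: assms)
  moreover have "linear f'"
    using assms by (rule has_derivative_linear)
  ultimately show ?thesis
    unfolding dir_deriv_def
    by (intro vector_derivative_at) (simp add: has_vector_derivative_def linear_scale)
qed

lemma dir_deriv_add:
  fixes f g :: "'a::real_normed_vector \<Rightarrow> 'b::real_normed_vector"
  assumes "\<And>x. f differentiable at x" "\<And>x. g differentiable at x"
  shows "dir_deriv v (f + g) = dir_deriv v f + dir_deriv v g"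
proof
  fix x
  obtain f' g' where d: "(f has_derivative f') (at x)" "(g has_derivative g') (at x)"
    using assms unfolding differentiable_def by metis
  from has_derivative_add[OF this] show "dir_deriv v (f + g) x = (dir_deriv v f + dir_deriv v g) x"
    by (simp add: dir_deriv_eq[OF d(1)] dir_deriv_eq[OF d(2)] dir_deriv_eq plus_fun_def)
qed

lemma dir_deriv_mult:
  fixes f g :: "'a::real_normed_vector \<Rightarrow> 'b::real_normed_algebra"
  assumes "\<And>x. f differentiable at x" "\<And>x. g differentiable at x"
  shows "dir_deriv v (f * g) = dir_deriv v f * g + f * dir_deriv v g"
proof
  fix x
  obtain f' g' where d: "(f has_derivative f') (at x)" "(g has_derivative g') (at x)"
    using assms unfolding differentiable_def by metis
  from has_derivative_mult[OF this] show "dir_deriv v (f * g) x = (dir_deriv v f * g + f * dir_deriv v g) x"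
    by (simp add: dir_deriv_eq[OF d(1)] dir_deriv_eq[OF d(2)] dir_deriv_eq plus_fun_def times_fun_def)
qed

lemma dir_deriv_const [simp]: "dir_deriv v (\<lambda>_. c) = 0"
  by (rule ext) (simp add: dir_deriv_eq[OF has_derivative_const])

lemma dir_deriv_zero [simp]: "dir_deriv v 0 = 0"
  using dir_deriv_const[of v 0] by (simp add: zero_fun_def)

lemma dir_deriv_linear:
  fixes l :: "'a::euclidean_space \<Rightarrow> 'b::real_normed_vector"
  assumes "linear l"
  shows "dir_deriv v l = (\<lambda>_. l v)"
  by (rule ext) (simp add: dir_deriv_eq[OF linear_imp_has_derivative[OF assms]])

lemma dir_deriv_exp:
  fixes l :: "'a::euclidean_space \<Rightarrow> complex"
  assumes "linear l"
  shows "dir_deriv v (\<lambda>x. exp (l x)) = (\<lambda>_. l v) * (\<lambda>x. exp (l x))"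
proof
  fix x
  have "((\<lambda>x. exp (l x)) has_derivative (\<lambda>v. exp (l x) * l v)) (at x)"
    using linear_imp_has_derivative[OF assms]
      DERIV_exp[of "l x", unfolded has_field_derivative_def]
    by (rule has_derivative_compose)
  from dir_deriv_eq[OF this] show "dir_deriv v (\<lambda>x. exp (l x)) x = ((\<lambda>_. l v) * (\<lambda>x. exp (l x))) x"
    by simp
qed

text \<open>
  All functions that occur are polynomials in linear forms and their exponentials. On this class
  directional derivatives commute by induction, so that no theorem on mixed partial derivatives of
  smooth functions is needed.
\<close>

inductive_set poly_exp :: "('a::euclidean_space \<Rightarrow> complex) set" where
  const: "(\<lambda>_. c) \<in> poly_exp"
| linear: "linear l \<Longrightarrow> l \<in> poly_exp"
| exp: "linear l \<Longrightarrow> (\<lambda>x. exp (l x)) \<in> poly_exp"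
| add: "f \<in> poly_exp \<Longrightarrow> g \<in> poly_exp \<Longrightarrow> f + g \<in> poly_exp"
| mult: "f \<in> poly_exp \<Longrightarrow> g \<in> poly_exp \<Longrightarrow> f * g \<in> poly_exp"

lemma poly_exp_differentiable:
  assumes "f \<in> poly_exp"
  shows "f differentiable at x"
  using assms
proof (induction rule: poly_exp.induct)
  case (linear l)
  then show ?case
    using differentiable_def linear_imp_has_derivative by blast
next
  case (exp l)
  have "((\<lambda>x. exp (l x)) has_derivative (\<lambda>v. exp (l x) * l v)) (at x)"
    using linear_imp_has_derivative[OF exp]
      DERIV_exp[of "l x", unfolded has_field_derivative_def]
    by (rule has_derivative_compose)
  then show ?case
    using differentiable_def by blast
qed (simp_all add: plus_fun_def times_fun_def)

lemmas poly_exp_dir_deriv_add =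
  dir_deriv_add[OF poly_exp_differentiable poly_exp_differentiable]
lemmas poly_exp_dir_deriv_mult =
  dir_deriv_mult[OF poly_exp_differentiable poly_exp_differentiable]

lemma poly_exp_zero [simp]: "0 \<in> poly_exp"
  unfolding zero_fun_def by (rule poly_exp.const)

lemma poly_exp_one [simp]: "1 \<in> poly_exp"
  unfolding one_fun_def by (rule poly_exp.const)

lemma poly_exp_uminus [simp]: "f \<in> poly_exp \<Longrightarrow> - f \<in> poly_exp"
  using poly_exp.mult[OF poly_exp.const[of "-1"], of f]
  by (simp add: times_fun_def fun_Compl_def)

lemma poly_exp_diff: "f \<in> poly_exp \<Longrightarrow> g \<in> poly_exp \<Longrightarrow> f - g \<in> poly_exp"
  using poly_exp.add[of f "- g"] by simp

lemma poly_exp_sum: "(\<And>i. i \<in> I \<Longrightarrow> f i \<in> poly_exp) \<Longrightarrow> sum f I \<in> poly_exp"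
  by (induction I rule: infinite_finite_induct) (auto intro: poly_exp.add)

text \<open>
  Induction over functions produces eta-expanded goals, in which the pointwise simplification rules
  would tear apart the sums and products.
\<close>

lemma poly_exp_dir_deriv: "f \<in> poly_exp \<Longrightarrow> dir_deriv v f \<in> poly_exp"
  by (induction rule: poly_exp.induct)
    (auto simp: dir_deriv_linear dir_deriv_exp poly_exp_dir_deriv_add poly_exp_dir_deriv_mult
      simp del: plus_fun_apply times_fun_apply zero_fun_apply intro: poly_exp.intros)

lemma poly_exp_dir_deriv_cmult:
  "f \<in> poly_exp \<Longrightarrow> dir_deriv v ((\<lambda>_. c) * f) = (\<lambda>_. c) * dir_deriv v f"
  by (subst poly_exp_dir_deriv_mult) (auto intro: poly_exp.const)

lemma poly_exp_dir_deriv_uminus: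
  assumes "f \<in> poly_exp"
  shows "dir_deriv v (- f) = - dir_deriv v f"
proof -
  have "- g = (\<lambda>_. - 1) * g" for g :: "'a \<Rightarrow> complex"
    by (auto simp: fun_eq_iff)
  then show ?thesis
    using poly_exp_dir_deriv_cmult[OF assms] by metis
qed

lemma poly_exp_dir_deriv_diff:
  "f \<in> poly_exp \<Longrightarrow> g \<in> poly_exp \<Longrightarrow> dir_deriv v (f - g) = dir_deriv v f - dir_deriv v g"
  using poly_exp_dir_deriv_add[of f "- g"] by (simp add: poly_exp_dir_deriv_uminus)

lemma poly_exp_dir_deriv_sum:
  "(\<And>i. i \<in> I \<Longrightarrow> f i \<in> poly_exp) \<Longrightarrow> dir_deriv v (sum f I) = (\<Sum>i\<in>I. dir_deriv v (f i))"
  by (induction I rule: infinite_finite_induct) (auto simp: poly_exp_dir_deriv_add poly_exp_sum)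

text \<open>Additivity in the direction is what later splits an operator along a diagonal embedding
  into the operators of the identified copies.\<close>

lemma poly_exp_dir_deriv_add_dir:
  "f \<in> poly_exp \<Longrightarrow> dir_deriv (v + w) f = dir_deriv v f + dir_deriv w f"
proof (induction rule: poly_exp.induct)
  case (linear l)
  then show ?case by (auto simp: dir_deriv_linear linear_add)
next
  case (exp l)
  then show ?case by (auto simp: dir_deriv_exp linear_add fun_eq_iff algebra_simps)
qed (simp_all add: poly_exp_dir_deriv_add poly_exp_dir_deriv_mult algebra_simps
    del: plus_fun_apply times_fun_apply zero_fun_apply)

lemma poly_exp_dir_deriv_commute:
  "f \<in> poly_exp \<Longrightarrow> dir_deriv v (dir_deriv w f) = dir_deriv w (dir_deriv v f)"
proof (induction rule: poly_exp.induct)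
  case (exp l)
  then show ?case
    by (simp add: dir_deriv_exp poly_exp_dir_deriv_cmult poly_exp.exp ac_simps
        del: plus_fun_apply times_fun_apply zero_fun_apply)
qed (simp_all add: dir_deriv_linear poly_exp_dir_deriv_add poly_exp_dir_deriv_mult
    poly_exp_dir_deriv poly_exp.add poly_exp.mult algebra_simps
    del: plus_fun_apply times_fun_apply zero_fun_apply)

lemma poly_exp_compose_linear:
  assumes "f \<in> poly_exp" "linear L"
  shows "f \<circ> L \<in> poly_exp"
  using assms(1)
proof (induction rule: poly_exp.induct)
  case (add f g)
  then show ?case
    using poly_exp.add[of "f \<circ> L" "g \<circ> L"] by (simp add: plus_fun_def comp_def)
next
  case (mult f g)
  then show ?case
    using poly_exp.mult[of "f \<circ> L" "g \<circ> L"] by (simp add: times_fun_def comp_def)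
next
  case (linear l)
  show ?case using linear_compose[OF assms(2) linear] by (rule poly_exp.linear)
next
  case (exp l)
  then show ?case using poly_exp.exp[of "l \<circ> L"] linear_compose[OF assms(2), of l]
    by (simp add: comp_def)
qed (auto simp: comp_def intro: poly_exp.const)

lemma poly_exp_dir_deriv_compose_linear:
  fixes L :: "'b::euclidean_space \<Rightarrow> 'a::euclidean_space"
  assumes "f \<in> poly_exp" "linear L"
  shows "dir_deriv v (f \<circ> L) = dir_deriv (L v) f \<circ> L"
proof
  fix x
  obtain f' where f': "(f has_derivative f') (at (L x))"
    using poly_exp_differentiable[OF assms(1)] unfolding differentiable_def by blast
  have "(f \<circ> L has_derivative f' \<circ> L) (at x)"
    using linear_imp_has_derivative[OF assms(2)] f' by (rule diff_chain_at)
  from dir_deriv_eq[OF this] dir_deriv_eq[OF f']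
  show "dir_deriv v (f \<circ> L) x = (dir_deriv (L v) f \<circ> L) x"
    by simp
qed

lemma poly_exp_smooth: "f \<in> poly_exp \<Longrightarrow> smooth f"
proof -
  assume "f \<in> poly_exp"
  then have "foldr dir_deriv vs f \<in> poly_exp" for vs
    by (induction vs) (auto intro: poly_exp_dir_deriv)
  then show ?thesis
    unfolding smooth_def using poly_exp_differentiable by blast
qed

text \<open>
  The Poisson bidifferential operator in which \<open>\<iota>\<close> and \<open>\<kappa>\<close> embed the phase space as two of the
  copies of which the domain of \<open>K\<close> is the product.
\<close>

definition bivec :: "('n::finite phase \<Rightarrow> 'a) \<Rightarrow> ('n phase \<Rightarrow> 'a) \<Rightarrow>
    ('a::euclidean_space \<Rightarrow> complex) \<Rightarrow> 'a \<Rightarrow> complex" where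
  "bivec \<iota> \<kappa> K = (\<Sum>j\<in>UNIV.
       dir_deriv (\<iota> (axis j 1, 0)) (dir_deriv (\<kappa> (0, axis j 1)) K)
     - dir_deriv (\<kappa> (axis j 1, 0)) (dir_deriv (\<iota> (0, axis j 1)) K))"

lemma sum_fun_apply: "sum f A x = (\<Sum>i\<in>A. f i x)"
  by (induction A rule: infinite_finite_induct) auto

lemma weyl_op_eq_bivec: "weyl_op = bivec (\<lambda>v. (v, 0)) (\<lambda>v. (0, v))"
  by (intro ext) (simp add: weyl_op_def bivec_def sum_fun_apply zero_prod_def)

lemma bivec_poly_exp: "f \<in> poly_exp \<Longrightarrow> bivec \<iota> \<kappa> f \<in> poly_exp"
  unfolding bivec_def by (intro poly_exp_sum poly_exp_diff poly_exp_dir_deriv)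

lemma bivec_add:
  "f \<in> poly_exp \<Longrightarrow> g \<in> poly_exp \<Longrightarrow> bivec \<iota> \<kappa> (f + g) = bivec \<iota> \<kappa> f + bivec \<iota> \<kappa> g"
  unfolding bivec_def
  by (simp add: poly_exp_dir_deriv_add poly_exp_dir_deriv sum.distrib[symmetric] algebra_simps)

lemma bivec_cmult:
  "f \<in> poly_exp \<Longrightarrow> bivec \<iota> \<kappa> ((\<lambda>_. c) * f) = (\<lambda>_. c) * bivec \<iota> \<kappa> f"
  unfolding bivec_def
  by (simp add: poly_exp_dir_deriv_cmult poly_exp_dir_deriv sum_distrib_left right_diff_distrib)

lemma bivec_dir_deriv:
  assumes "f \<in> poly_exp"
  shows "bivec \<iota> \<kappa> (dir_deriv v f) = dir_deriv v (bivec \<iota> \<kappa> f)"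
proof -
  have "dir_deriv a (dir_deriv b (dir_deriv v f)) = dir_deriv v (dir_deriv a (dir_deriv b f))" for a b
    using assms by (metis poly_exp_dir_deriv poly_exp_dir_deriv_commute)
  then show ?thesis
    unfolding bivec_def using assms
    by (simp add: poly_exp_dir_deriv_sum poly_exp_dir_deriv_diff poly_exp_diff poly_exp_dir_deriv)
qed

lemma bivec_diff:
  "f \<in> poly_exp \<Longrightarrow> g \<in> poly_exp \<Longrightarrow> bivec \<iota> \<kappa> (f - g) = bivec \<iota> \<kappa> f - bivec \<iota> \<kappa> g"
  by (metis add_diff_cancel_right' bivec_add diff_add_cancel poly_exp_diff)

lemma bivec_zero [simp]: "bivec \<iota> \<kappa> 0 = 0"
  unfolding bivec_def by simp

lemma bivec_sum:
  "(\<And>i. i \<in> I \<Longrightarrow> f i \<in> poly_exp) \<Longrightarrow> bivec \<iota> \<kappa> (sum f I) = (\<Sum>i\<in>I. bivec \<iota> \<kappa> (f i))"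
  by (induction I rule: infinite_finite_induct) (auto simp: bivec_add poly_exp_sum)

text \<open>The operators have constant coefficients, so they commute because directional
  derivatives do. This licenses the law exp(A + B) = exp A exp B in the associativity proof.\<close>

lemma bivec_commute:
  assumes "f \<in> poly_exp"
  shows "bivec \<iota> \<kappa> (bivec \<iota>' \<kappa>' f) = bivec \<iota>' \<kappa>' (bivec \<iota> \<kappa> f)"
  unfolding bivec_def[of \<iota>' \<kappa>'] using assms
  by (simp add: bivec_sum bivec_diff poly_exp_dir_deriv poly_exp_diff bivec_dir_deriv)

lemma bivec_add_left:
  assumes "f \<in> poly_exp"
  shows "bivec (\<lambda>v. \<iota> v + \<iota>' v) \<kappa> f = bivec \<iota> \<kappa> f + bivec \<iota>' \<kappa> f"
  unfolding bivec_def using assms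
  by (simp add: poly_exp_dir_deriv poly_exp_dir_deriv_add_dir poly_exp_dir_deriv_add
      sum.distrib[symmetric] algebra_simps)

lemma bivec_add_right:
  assumes "f \<in> poly_exp"
  shows "bivec \<iota> (\<lambda>v. \<kappa> v + \<kappa>' v) f = bivec \<iota> \<kappa> f + bivec \<iota> \<kappa>' f"
  unfolding bivec_def using assms
  by (simp add: poly_exp_dir_deriv poly_exp_dir_deriv_add_dir poly_exp_dir_deriv_add
      sum.distrib[symmetric] algebra_simps)

lemma bivec_compose_linear:
  assumes "f \<in> poly_exp" "linear L"
  shows "bivec \<iota> \<kappa> (f \<circ> L) = bivec (L \<circ> \<iota>) (L \<circ> \<kappa>) f \<circ> L"
  unfolding bivec_def using assms
  by (simp add: poly_exp_dir_deriv_compose_linear poly_exp_dir_deriv fun_eq_iff sum_fun_apply)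

lemma bivec_mult:
  assumes "f \<in> poly_exp" "h \<in> poly_exp"
    and "\<And>v. dir_deriv (\<iota> v) h = 0" "\<And>v. dir_deriv (\<kappa> v) h = 0"
  shows "bivec \<iota> \<kappa> (f * h) = bivec \<iota> \<kappa> f * h"
  unfolding bivec_def using assms
  by (simp add: poly_exp_dir_deriv_mult poly_exp_dir_deriv sum_distrib_right left_diff_distrib)

subsection \<open>Associativity of the star product\<close>

definition poly_exp_op :: "(('a::euclidean_space \<Rightarrow> complex) \<Rightarrow> 'a \<Rightarrow> complex) \<Rightarrow> bool" where
  "poly_exp_op B \<longleftrightarrow> (\<forall>f\<in>poly_exp. B f \<in> poly_exp) \<and>
     (\<forall>f\<in>poly_exp. \<forall>g\<in>poly_exp. B (f + g) = B f + B g) \<and>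
     (\<forall>f\<in>poly_exp. \<forall>c. B ((\<lambda>_. c) * f) = (\<lambda>_. c) * B f)"

lemma poly_exp_op_closed: "poly_exp_op B \<Longrightarrow> f \<in> poly_exp \<Longrightarrow> B f \<in> poly_exp"
  and poly_exp_op_add: "poly_exp_op B \<Longrightarrow> f \<in> poly_exp \<Longrightarrow> g \<in> poly_exp \<Longrightarrow> B (f + g) = B f + B g"
  and poly_exp_op_cmult: "poly_exp_op B \<Longrightarrow> f \<in> poly_exp \<Longrightarrow> B ((\<lambda>_. c) * f) = (\<lambda>_. c) * B f"
  by (simp_all add: poly_exp_op_def)

lemma poly_exp_op_zero: "poly_exp_op B \<Longrightarrow> B 0 = 0"
  using poly_exp_op_add[of B 0 0] by simp

lemma poly_exp_op_sum:
  "poly_exp_op B \<Longrightarrow> (\<And>i. i \<in> I \<Longrightarrow> f i \<in> poly_exp) \<Longrightarrow> B (sum f I) = (\<Sum>i\<in>I. B (f i))"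
  by (induction I rule: infinite_finite_induct)
    (auto simp: poly_exp_op_zero poly_exp_op_add poly_exp_sum)

lemma poly_exp_op_bivec [simp]: "poly_exp_op (bivec \<iota> \<kappa>)"
  by (simp add: poly_exp_op_def bivec_poly_exp bivec_add bivec_cmult)

lemma poly_exp_op_plus [simp]:
  "poly_exp_op B \<Longrightarrow> poly_exp_op C \<Longrightarrow> poly_exp_op (\<lambda>f. B f + C f)"
  unfolding poly_exp_op_def by (simp add: poly_exp.add distrib_left algebra_simps)

lemma poly_exp_op_funpow [simp]:
  assumes "poly_exp_op B"
  shows "poly_exp_op (B ^^ k)"
proof (induction k)
  case 0
  then show ?case by (simp add: poly_exp_op_def)
next
  case (Suc k)
  then show ?case using assms by (simp add: poly_exp_op_def)
qed

text \<open>Pascal's rule, arranged for the induction step of the binomial theorem;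
  \<open>z k l\<close> stands for the k-th power of one operator after the l-th power of
  another.\<close>

lemma sum_choose_Suc:
  fixes z :: "nat \<Rightarrow> nat \<Rightarrow> 'a::semiring_1"
  shows "(\<Sum>k\<le>m. of_nat (m choose k) * (z (Suc k) (m - k) + z k (Suc (m - k)))) =
    (\<Sum>k\<le>Suc m. of_nat (Suc m choose k) * z k (Suc m - k))"
proof -
  have 1: "(\<Sum>k\<le>m. of_nat (m choose k) * z k (Suc (m - k))) =
      z 0 (Suc m) + (\<Sum>k\<le>m. of_nat (m choose Suc k) * z (Suc k) (m - k))"
  proof -
    have "(\<Sum>k\<le>m. of_nat (m choose k) * z k (Suc (m - k))) =
        (\<Sum>k\<le>Suc m. of_nat (m choose k) * z k (Suc m - k))"
      by (simp add: Suc_diff_le binomial_eq_0)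
    also have "\<dots> = z 0 (Suc m) + (\<Sum>k\<le>m. of_nat (m choose Suc k) * z (Suc k) (m - k))"
      by (subst sum.atMost_Suc_shift) simp
    finally show ?thesis .
  qed
  have "(\<Sum>k\<le>Suc m. of_nat (Suc m choose k) * z k (Suc m - k)) =
      z 0 (Suc m) + (\<Sum>k\<le>m. of_nat ((m choose k) + (m choose Suc k)) * z (Suc k) (m - k))"
    by (subst sum.atMost_Suc_shift) (simp del: of_nat_add)
  also have "\<dots> = (\<Sum>k\<le>m. of_nat (m choose k) * (z (Suc k) (m - k) + z k (Suc (m - k))))"
    unfolding distrib_left sum.distrib 1 of_nat_add distrib_right by (simp add: add_ac)
  finally show ?thesis ..
qed

lemma funpow_plus_binomial:
  assumes "poly_exp_op B" "poly_exp_op C" "\<And>f. f \<in> poly_exp \<Longrightarrow> C (B f) = B (C f)"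
    and "f \<in> poly_exp"
  shows "((\<lambda>f. B f + C f) ^^ m) f = (\<Sum>k\<le>m. of_nat (m choose k) * (B ^^ k) ((C ^^ (m - k)) f))"
proof (induction m)
  case (Suc m)
  have CB: "C ((B ^^ k) g) = (B ^^ k) (C g)" if "g \<in> poly_exp" for k g
  proof (induction k)
    case (Suc k)
    have "C (B ((B ^^ k) g)) = B (C ((B ^^ k) g))"
      by (rule assms(3)) (simp add: poly_exp_op_closed assms(1) that)
    then show ?case
      by (simp add: Suc)
  qed simp
  have pe: "(B ^^ k) ((C ^^ l) f) \<in> poly_exp" for k l
    using assms by (simp add: poly_exp_op_closed)
  \<comment> \<open>Numerals in the ring of functions are constant functions, so that homogeneity
    under complex scalars applies to the binomial coefficients.\<close>
  have of_nat: "of_nat i * g = (\<lambda>_. of_nat i) * g" for i and g :: "'a \<Rightarrow> complex"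
    by (simp add: of_nat_fun)
  have pe': "of_nat i * (B ^^ k) ((C ^^ l) f) \<in> poly_exp" for i k l
    unfolding of_nat by (intro poly_exp.mult poly_exp.const pe)
  have B: "B (of_nat i * (B ^^ k) ((C ^^ l) f)) = of_nat i * (B ^^ Suc k) ((C ^^ l) f)" for i k l
    unfolding of_nat funpow.simps comp_apply by (rule poly_exp_op_cmult[OF assms(1) pe])
  have C: "C (of_nat i * (B ^^ k) ((C ^^ l) f)) = of_nat i * (B ^^ k) ((C ^^ Suc l) f)" for i k l
    unfolding of_nat funpow.simps comp_apply poly_exp_op_cmult[OF assms(2) pe]
    by (simp only: CB poly_exp_op_closed[OF poly_exp_op_funpow[OF assms(2)] assms(4)])
  have "((\<lambda>f. B f + C f) ^^ Suc m) f =
      (\<Sum>k\<le>m. of_nat (m choose k) * ((B ^^ Suc k) ((C ^^ (m - k)) f) + (B ^^ k) ((C ^^ Suc (m - k)) f)))"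
    unfolding funpow.simps comp_def Suc poly_exp_op_sum[OF assms(1) pe'] poly_exp_op_sum[OF assms(2) pe']
      B[unfolded funpow.simps comp_def] C[unfolded funpow.simps comp_def]
    by (simp add: distrib_left sum.distrib)
  then show ?case
    by (simp only: sum_choose_Suc[where z = "\<lambda>k l. (B ^^ k) ((C ^^ l) f)"])
qed simp

text \<open>The formal exponential exp(\<i>\<hbar>B/2) applied to a series. Separating it from the
  restriction to the diagonal allows exponentials of several operators to be composed before
  restricting.\<close>

definition weyl_exp :: "(('a \<Rightarrow> complex) \<Rightarrow> 'a \<Rightarrow> complex) \<Rightarrow> ('a \<Rightarrow> complex) fps \<Rightarrow> ('a \<Rightarrow> complex) fps" where
  "weyl_exp B K = Abs_fps (\<lambda>m. \<Sum>k\<le>m. (\<lambda>_. (\<i> / 2) ^ k / fact k) * (B ^^ k) (fps_nth K (m - k)))"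

definition poly_exp_fps :: "('a::euclidean_space \<Rightarrow> complex) fps set" where
  "poly_exp_fps = {K. \<forall>m. fps_nth K m \<in> poly_exp}"

lemma poly_exp_fps_nth: "K \<in> poly_exp_fps \<Longrightarrow> fps_nth K m \<in> poly_exp"
  by (simp add: poly_exp_fps_def)

lemma poly_exp_fps_add: "K \<in> poly_exp_fps \<Longrightarrow> H \<in> poly_exp_fps \<Longrightarrow> K + H \<in> poly_exp_fps"
  by (simp add: poly_exp_fps_def poly_exp.add)

lemma poly_exp_fps_uminus: "K \<in> poly_exp_fps \<Longrightarrow> - K \<in> poly_exp_fps"
  by (simp add: poly_exp_fps_def)

lemma poly_exp_fps_mult: "K \<in> poly_exp_fps \<Longrightarrow> H \<in> poly_exp_fps \<Longrightarrow> K * H \<in> poly_exp_fps"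
  by (auto simp: poly_exp_fps_def fps_mult_nth intro!: poly_exp_sum poly_exp.mult)

lemma poly_exp_fps_const [simp]: "f \<in> poly_exp \<Longrightarrow> fps_const f \<in> poly_exp_fps"
  by (simp add: poly_exp_fps_def)

lemma weyl_exp_closed: "poly_exp_op B \<Longrightarrow> K \<in> poly_exp_fps \<Longrightarrow> weyl_exp B K \<in> poly_exp_fps"
  by (auto simp: poly_exp_fps_def weyl_exp_def
      intro!: poly_exp_sum poly_exp.mult poly_exp.const poly_exp_op_closed[OF poly_exp_op_funpow])

lemma weyl_exp_add:
  "poly_exp_op B \<Longrightarrow> K \<in> poly_exp_fps \<Longrightarrow> H \<in> poly_exp_fps \<Longrightarrow>
    weyl_exp B (K + H) = weyl_exp B K + weyl_exp B H"
  by (rule fps_ext)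
    (simp add: weyl_exp_def poly_exp_fps_def poly_exp_op_add[OF poly_exp_op_funpow]
      distrib_left sum.distrib)

text \<open>The exponential law for commuting operators: the factor 1/s! times a binomial
  coefficient splits as 1/(k! (s - k)!), and the triangle k + l \<le> m is summed in two
  ways.\<close>

lemma weyl_exp_plus:
  assumes "poly_exp_op B" "poly_exp_op C" "\<And>f. f \<in> poly_exp \<Longrightarrow> C (B f) = B (C f)"
    and K: "K \<in> poly_exp_fps"
  shows "weyl_exp (\<lambda>f. B f + C f) K = weyl_exp B (weyl_exp C K)"
proof (rule fps_ext)
  fix m
  define c :: "nat \<Rightarrow> 'a \<Rightarrow> complex" where "c k = (\<lambda>_. (\<i> / 2) ^ k / fact k)" for k
  define g where "g k l = c k * c l * (B ^^ k) ((C ^^ l) (fps_nth K (m - (k + l))))" for k l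
  note [simp] = poly_exp_fps_nth[OF K]
  have cc: "c s * of_nat (s choose k) = c k * c (s - k)" if "k \<le> s" for k s
    using that
    by (auto simp: c_def fun_eq_iff binomial_fact power_add[symmetric])
  have "fps_nth (weyl_exp (\<lambda>f. B f + C f) K) m = (\<Sum>s\<le>m. \<Sum>k\<le>s. g k (s - k))"
    unfolding weyl_exp_def c_def[symmetric] fps_nth_Abs_fps
  proof (rule sum.cong)
    fix s
    assume "s \<in> {..m}"
    then show "c s * ((\<lambda>f. B f + C f) ^^ s) (fps_nth K (m - s)) = (\<Sum>k\<le>s. g k (s - k))"
      by (simp add: funpow_plus_binomial[OF assms(1-3)] g_def sum_distrib_left cc
          mult.assoc[symmetric])
  qed simp
  also have "\<dots> = (\<Sum>(k, l)\<in>{(k, l). k + l \<le> m}. g k l)"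
    by (rule sum.triangle_reindex_eq[symmetric])
  also have "{(k, l). k + l \<le> m} = Sigma {..m} (\<lambda>k. {..m - k})"
    by auto
  also have "(\<Sum>(k, l)\<in>\<dots>. g k l) = (\<Sum>k\<le>m. \<Sum>l\<le>m - k. g k l)"
    by (simp add: sum.Sigma)
  also have "\<dots> = fps_nth (weyl_exp B (weyl_exp C K)) m"
    unfolding weyl_exp_def c_def[symmetric] fps_nth_Abs_fps
  proof (rule sum.cong)
    fix k
    have pe: "(C ^^ l) (fps_nth K j) \<in> poly_exp" for l j
      using assms(2) by (simp add: poly_exp_op_closed)
    have "(B ^^ k) (\<Sum>l\<le>m - k. c l * (C ^^ l) (fps_nth K (m - k - l)))
        = (\<Sum>l\<le>m - k. c l * (B ^^ k) ((C ^^ l) (fps_nth K (m - k - l))))"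
      using poly_exp_op_funpow[OF assms(1)] unfolding c_def
      by (simp only: poly_exp_op_sum poly_exp_op_cmult pe poly_exp.mult poly_exp.const)
    then show "(\<Sum>l\<le>m - k. g k l) = c k * (B ^^ k) (\<Sum>l\<le>m - k. c l * (C ^^ l) (fps_nth K (m - k - l)))"
      by (simp add: g_def sum_distrib_left mult.assoc)
  qed simp
  finally show "fps_nth (weyl_exp (\<lambda>f. B f + C f) K) m = fps_nth (weyl_exp B (weyl_exp C K)) m" .
qed

text \<open>Agreement on the class is enough, since all iterates stay in it.\<close>

lemma weyl_exp_cong:
  assumes "\<And>f. f \<in> poly_exp \<Longrightarrow> B f = C f" "poly_exp_op B" "K \<in> poly_exp_fps"
  shows "weyl_exp B K = weyl_exp C K"
proof -
  have "(B ^^ k) f = (C ^^ k) f" if "f \<in> poly_exp" for f k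
  proof (induction k)
    case (Suc k)
    then show ?case
      using assms(1)[OF poly_exp_op_closed[OF poly_exp_op_funpow[OF assms(2)] that]]
      by (simp add: Suc[symmetric])
  qed simp
  then show ?thesis
    using assms(3) by (simp add: weyl_exp_def poly_exp_fps_def)
qed

text \<open>The derivatives in the operator do not see H, which therefore behaves like a constant
  factor under all its powers.\<close>

lemma weyl_exp_mult:
  assumes K: "K \<in> poly_exp_fps" and H: "H \<in> poly_exp_fps"
    and "\<And>v m. dir_deriv (\<iota> v) (fps_nth H m) = 0" "\<And>v m. dir_deriv (\<kappa> v) (fps_nth H m) = 0"
  shows "weyl_exp (bivec \<iota> \<kappa>) (K * H) = weyl_exp (bivec \<iota> \<kappa>) K * H"
proof (rule fps_ext)
  fix m
  define c :: "nat \<Rightarrow> 'a \<Rightarrow> complex" where "c k = (\<lambda>_. (\<i> / 2) ^ k / fact k)" for k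
  let ?B = "bivec \<iota> \<kappa>"
  define g where "g i k = c k * (?B ^^ k) (fps_nth K i) * fps_nth H (m - (i + k))" for i k
  note [simp] = poly_exp_fps_nth[OF K] poly_exp_fps_nth[OF H]
  have pow: "(?B ^^ k) (fps_nth K i * fps_nth H j) = (?B ^^ k) (fps_nth K i) * fps_nth H j" for i j k
  proof (induction k)
    case (Suc k)
    show ?case
      unfolding funpow.simps comp_apply Suc
      by (rule bivec_mult) (simp_all add: poly_exp_op_closed assms(3,4))
  qed simp
  have "fps_nth (weyl_exp ?B (K * H)) m = (\<Sum>k\<le>m. \<Sum>i\<le>m - k. g i k)"
    unfolding weyl_exp_def c_def[symmetric] fps_nth_Abs_fps
    by (simp add: fps_mult_nth poly_exp_op_sum[OF poly_exp_op_funpow] poly_exp.mult pow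
        sum_distrib_left g_def mult.assoc atLeast0AtMost add.commute)
  also have "\<dots> = (\<Sum>(k, i)\<in>Sigma {..m} (\<lambda>k. {..m - k}). g i k)"
    by (simp add: sum.Sigma)
  also have "Sigma {..m} (\<lambda>k. {..m - k}) = {(k, i). k + i \<le> m}"
    by auto
  also have "(\<Sum>(k, i)\<in>\<dots>. g i k) = (\<Sum>s\<le>m. \<Sum>k\<le>s. g (s - k) k)"
    by (rule sum.triangle_reindex_eq)
  also have "\<dots> = fps_nth (weyl_exp ?B K * H) m"
    unfolding weyl_exp_def c_def[symmetric]
    by (simp add: fps_mult_nth atLeast0AtMost g_def sum_distrib_right)
  finally show "fps_nth (weyl_exp ?B (K * H)) m = fps_nth (weyl_exp ?B K * H) m" .
qed

section \<open>Pullback along linear maps and the star product as a restricted exponential\<close>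

definition fps_pullback :: "('b \<Rightarrow> 'a) \<Rightarrow> ('a \<Rightarrow> complex) fps \<Rightarrow> ('b \<Rightarrow> complex) fps" where
  "fps_pullback L K = Abs_fps (\<lambda>m. fps_nth K m \<circ> L)"

lemma fps_pullback_closed:
  "K \<in> poly_exp_fps \<Longrightarrow> linear L \<Longrightarrow> fps_pullback L K \<in> poly_exp_fps"
  by (simp add: poly_exp_fps_def fps_pullback_def poly_exp_compose_linear)

lemma fps_pullback_add: "fps_pullback L (K + H) = fps_pullback L K + fps_pullback L H"
  by (rule fps_ext) (simp add: fps_pullback_def fun_eq_iff)

lemma fps_pullback_mult: "fps_pullback L (K * H) = fps_pullback L K * fps_pullback L H"
  by (rule fps_ext) (simp add: fps_pullback_def fun_eq_iff fps_mult_nth sum_fun_apply)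

lemma fps_pullback_pullback: "fps_pullback L (fps_pullback M K) = fps_pullback (M \<circ> L) K"
  by (simp add: fps_pullback_def comp_assoc)

text \<open>Chain rule for a linear map: the derivative of f \<circ> L along v is that of f along L
  v, so the embeddings are pushed forward by L. It serves projections, where copies are added, as
  well as diagonals, where copies are identified.\<close>

lemma weyl_exp_pullback:
  assumes "K \<in> poly_exp_fps" "linear L"
  shows "weyl_exp (bivec \<iota> \<kappa>) (fps_pullback L K) =
    fps_pullback L (weyl_exp (bivec (L \<circ> \<iota>) (L \<circ> \<kappa>)) K)"
proof -
  have "(bivec \<iota> \<kappa> ^^ k) (f \<circ> L) = (bivec (L \<circ> \<iota>) (L \<circ> \<kappa>) ^^ k) f \<circ> L" if "f \<in> poly_exp" for f k
  proof (induction k)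
    case (Suc k)
    show ?case
      unfolding funpow.simps comp_apply[of "bivec _ _"] Suc
      by (rule bivec_compose_linear) (simp_all add: poly_exp_op_closed that assms(2))
  qed simp
  then show ?thesis
    using assms(1)
    by (auto intro!: fps_ext
        simp: weyl_exp_def fps_pullback_def poly_exp_fps_def fun_eq_iff sum_fun_apply)
qed

text \<open>The Cauchy product of the two pulled-back series on the doubled phase space absorbs the
  inner sum of the bilinear extension, which leaves a single exponential.\<close>

lemma star_eq_weyl_exp:
  assumes F: "F \<in> poly_exp_fps" and G: "G \<in> poly_exp_fps"
  shows "F \<star> G = fps_pullback (\<lambda>x. (x, x))
    (weyl_exp (bivec (\<lambda>v. (v, 0)) (\<lambda>v. (0, v))) (fps_pullback fst F * fps_pullback snd G))"
proof (rule fps_ext)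
  fix m
  define T where "T a b = (\<lambda>(y, y'). fps_nth F a y * fps_nth G b y')" for a b
  have T: "T a b = (fps_nth F a \<circ> fst) * (fps_nth G b \<circ> snd)" for a b
    by (auto simp: T_def)
  have pe: "T a b \<in> poly_exp" for a b
    unfolding T using F G
    by (intro poly_exp.mult poly_exp_compose_linear linear_fst linear_snd) (auto simp: poly_exp_fps_def)
  show "fps_nth (F \<star> G) m = fps_nth (fps_pullback (\<lambda>x. (x, x))
    (weyl_exp (bivec (\<lambda>v. (v, 0)) (\<lambda>v. (0, v))) (fps_pullback fst F * fps_pullback snd G))) m"
    by (simp add: star_def fps_pullback_def weyl_exp_def weyl_coeff_def weyl_op_eq_bivec fun_eq_iff
        fps_mult_nth sum_fun_apply T[symmetric] T_def[symmetric] atLeast0AtMost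
        poly_exp_op_sum[OF poly_exp_op_funpow] pe sum_distrib_left)
qed

lemma star_closed: "F \<in> poly_exp_fps \<Longrightarrow> G \<in> poly_exp_fps \<Longrightarrow> F \<star> G \<in> poly_exp_fps"
  by (simp add: star_eq_weyl_exp linear_fst linear_snd fps_pullback_closed weyl_exp_closed
      poly_exp_fps_mult linear_iff)

text \<open>A pullback along L is constant in the directions of the kernel of L. This shows that an
  operator on two of three copies does not touch a factor living on the third.\<close>

lemma dir_deriv_pullback_zero:
  fixes L :: "'b::euclidean_space \<Rightarrow> 'a::euclidean_space"
  assumes "f \<in> poly_exp" "linear L" "L v = 0"
  shows "dir_deriv v (f \<circ> L) = 0"
proof -
  have "dir_deriv 0 f = 0"
    using poly_exp_dir_deriv_add_dir[OF assms(1), of 0 0] by simp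
  then show ?thesis
    using poly_exp_dir_deriv_compose_linear[OF assms(1,2), of v] assms(3)
    by (simp add: fun_eq_iff)
qed

text \<open>
  Both sides of the associativity law are the pullback along \<open>x \<mapsto> (x, x, x)\<close> of
  \<open>exp (\<i>\<hbar>/2 (P\<^sub>1\<^sub>2 + P\<^sub>1\<^sub>3 + P\<^sub>2\<^sub>3))\<close>, since pulling \<open>P\<close> back along a diagonal adds up the
  operators of the two copies that the diagonal identifies.
\<close>

lemma star_assoc:
  fixes F G H :: "'n::finite obs fps"
  assumes F: "F \<in> poly_exp_fps" and G: "G \<in> poly_exp_fps" and H: "H \<in> poly_exp_fps"
  shows "F \<star> G \<star> H = F \<star> (G \<star> H)"
proof -
  define i1 i2 where "i1 = (\<lambda>v::'n phase. (v, 0::'n phase))" and "i2 = (\<lambda>v::'n phase. (0::'n phase, v))"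
  define j1 j2 j3 where "j1 = (\<lambda>v::'n phase. (v, 0::'n phase \<times> 'n phase))"
    and "j2 = (\<lambda>v::'n phase. (0::'n phase, v, 0::'n phase))"
    and "j3 = (\<lambda>v::'n phase. (0::'n phase, 0::'n phase, v))"
  define D :: "'n phase \<Rightarrow> 'n phase \<times> 'n phase" where "D x = (x, x)" for x
  define D12 D23 where "D12 = (\<lambda>(y::'n phase, z::'n phase). (y, y, z))"
    and "D23 = (\<lambda>(y::'n phase, z::'n phase). (y, z, z))"
  define p12 where "p12 = (\<lambda>(x::'n phase, y::'n phase, z::'n phase). (x, y))"
  define p1 p2 p3 where "p1 = (\<lambda>(x::'n phase, y::'n phase, z::'n phase). x)"
    and "p2 = (\<lambda>(x::'n phase, y::'n phase, z::'n phase). y)"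
    and "p3 = (\<lambda>(x::'n phase, y::'n phase, z::'n phase). z)"
  note lins = D_def D12_def D23_def p12_def p1_def p2_def p3_def i1_def i2_def j1_def j2_def j3_def
  have lin [simp]: "linear D" "linear D12" "linear D23" "linear p12" "linear p1" "linear p2" "linear p3"
      "linear (snd :: _ \<Rightarrow> 'n phase \<times> 'n phase)"
      "linear (fst :: _ \<Rightarrow> 'n phase)" "linear (snd :: _ \<Rightarrow> 'n phase)"
    by (auto simp: lins linear_iff)
  have pj [simp]: "p3 (j1 v) = 0" "p3 (j2 v) = 0" "p1 (j2 v) = 0" "p1 (j3 v) = 0" for v
    by (simp_all add: lins zero_prod_def)
  note [simp] = poly_exp_fps_mult fps_pullback_closed weyl_exp_closed F G H
  have zero: "dir_deriv v (fps_nth (fps_pullback L K) m) = 0"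
    if "K \<in> poly_exp_fps" "linear L" "L v = 0"
    for L :: "'n phase \<times> 'n phase \<times> 'n phase \<Rightarrow> 'n phase" and K m v
    using dir_deriv_pullback_zero[OF poly_exp_fps_nth[OF that(1)] that(2,3)]
    by (simp add: fps_pullback_def)
  let ?P12 = "bivec j1 j2" and ?P13 = "bivec j1 j3" and ?P23 = "bivec j2 j3"
  let ?F = "fps_pullback p1 F" and ?G = "fps_pullback p2 G" and ?H = "fps_pullback p3 H"
  let ?T = "?F * ?G * ?H"
  have star: "A \<star> B = fps_pullback D (weyl_exp (bivec i1 i2) (fps_pullback fst A * fps_pullback snd B))"
    if "A \<in> poly_exp_fps" "B \<in> poly_exp_fps" for A B
    using star_eq_weyl_exp[OF that] by (simp add: D_def[abs_def] i1_def i2_def)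
  \<comment> \<open>Since \<open>p12\<close> after \<open>D12\<close> is the diagonal after
    \<open>fst\<close>, the inner product can be computed on three copies, with the third one still
    free for H.\<close>
  have "fps_pullback fst (F \<star> G) =
      fps_pullback D12 (fps_pullback p12 (weyl_exp (bivec (p12 \<circ> j1) (p12 \<circ> j2))
        (fps_pullback fst F * fps_pullback snd G)))"
    unfolding star[OF F G] fps_pullback_pullback
    by (auto intro!: arg_cong2[of _ _ _ _ fps_pullback] arg_cong2[of _ _ _ _ weyl_exp]
        arg_cong2[of _ _ _ _ bivec] simp: lins zero_prod_def)
  also have "\<dots> = fps_pullback D12 (weyl_exp ?P12 (?F * ?G))"
    by (subst weyl_exp_pullback[symmetric])
      (auto simp: fps_pullback_mult fps_pullback_pullback
        intro!: arg_cong[of _ _ "fps_pullback D12"] arg_cong2[of _ _ _ _ weyl_exp]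
          arg_cong2[of _ _ _ _ "(*)"] arg_cong2[of _ _ _ _ fps_pullback], auto simp: lins)
  finally have FG: "fps_pullback fst (F \<star> G) = fps_pullback D12 (weyl_exp ?P12 (?F * ?G))" .
  have H3: "fps_pullback snd H = fps_pullback D12 ?H"
    unfolding fps_pullback_pullback by (rule arg_cong2[of _ _ _ _ fps_pullback]) (auto simp: lins)
  have "F \<star> G \<star> H = fps_pullback D (weyl_exp (bivec i1 i2) (fps_pullback D12 (weyl_exp ?P12 (?F * ?G) * ?H)))"
    by (simp add: star star_closed FG[unfolded star[OF F G]] H3 fps_pullback_mult)
  \<comment> \<open>The operator on copies one and two does not differentiate in copy three, so H
    may join the argument.\<close>
  also have "weyl_exp ?P12 (?F * ?G) * ?H = weyl_exp ?P12 ?T"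
    by (rule weyl_exp_mult[symmetric]) (simp_all add: zero)
  also have "weyl_exp (bivec i1 i2) (fps_pullback D12 (weyl_exp ?P12 ?T)) =
      fps_pullback D12 (weyl_exp (bivec (\<lambda>v. j1 v + j2 v) j3) (weyl_exp ?P12 ?T))"
    by (subst weyl_exp_pullback) (auto intro!: arg_cong[of _ _ "fps_pullback D12"]
      arg_cong2[of _ _ _ _ weyl_exp] arg_cong2[of _ _ _ _ bivec], auto simp: lins zero_prod_def)
  also have "weyl_exp (bivec (\<lambda>v. j1 v + j2 v) j3) (weyl_exp ?P12 ?T) =
      weyl_exp (\<lambda>f. bivec (\<lambda>v. j1 v + j2 v) j3 f + ?P12 f) ?T"
    by (rule weyl_exp_plus[symmetric]) (auto intro: bivec_commute)
  also have "\<dots> = weyl_exp (\<lambda>f. ?P12 f + ?P13 f + ?P23 f) ?T"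
    by (rule weyl_exp_cong) (auto simp: bivec_add_left)
  also have "fps_pullback D (fps_pullback D12 \<dots>) = fps_pullback (\<lambda>x. (x, x, x)) \<dots>"
    unfolding fps_pullback_pullback by (rule arg_cong2[of _ _ _ _ fps_pullback]) (auto simp: lins)
  finally have left: "F \<star> G \<star> H = \<dots>" .

  have "fps_pullback snd (G \<star> H) =
      fps_pullback D23 (fps_pullback snd (weyl_exp (bivec (snd \<circ> j2) (snd \<circ> j3))
        (fps_pullback fst G * fps_pullback snd H)))"
    unfolding star[OF G H] fps_pullback_pullback
    by (auto intro!: arg_cong2[of _ _ _ _ fps_pullback] arg_cong2[of _ _ _ _ weyl_exp]
        arg_cong2[of _ _ _ _ bivec] simp: lins zero_prod_def)
  also have "\<dots> = fps_pullback D23 (weyl_exp ?P23 (?G * ?H))"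
    by (subst weyl_exp_pullback[symmetric])
      (auto simp: fps_pullback_mult fps_pullback_pullback
        intro!: arg_cong[of _ _ "fps_pullback D23"] arg_cong2[of _ _ _ _ weyl_exp]
          arg_cong2[of _ _ _ _ "(*)"] arg_cong2[of _ _ _ _ fps_pullback], auto simp: lins)
  finally have GH: "fps_pullback snd (G \<star> H) = fps_pullback D23 (weyl_exp ?P23 (?G * ?H))" .
  have F1: "fps_pullback fst F = fps_pullback D23 ?F"
    unfolding fps_pullback_pullback by (rule arg_cong2[of _ _ _ _ fps_pullback]) (auto simp: lins)
  \<comment> \<open>F is moved to the right by commutativity of the pointwise product, because
    \<open>weyl_exp_mult\<close> absorbs right factors.\<close>
  have "F \<star> (G \<star> H) = fps_pullback D (weyl_exp (bivec i1 i2) (fps_pullback D23 (weyl_exp ?P23 (?G * ?H) * ?F)))"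
    by (simp add: star star_closed GH[unfolded star[OF G H]] F1 fps_pullback_mult mult.commute)
  also have "weyl_exp ?P23 (?G * ?H) * ?F = weyl_exp ?P23 (?G * ?H * ?F)"
    by (rule weyl_exp_mult[symmetric]) (simp_all add: zero)
  also have "?G * ?H * ?F = ?T"
    by (simp add: ac_simps)
  also have "weyl_exp (bivec i1 i2) (fps_pullback D23 (weyl_exp ?P23 ?T)) =
      fps_pullback D23 (weyl_exp (bivec j1 (\<lambda>v. j2 v + j3 v)) (weyl_exp ?P23 ?T))"
    by (subst weyl_exp_pullback) (auto intro!: arg_cong[of _ _ "fps_pullback D23"]
      arg_cong2[of _ _ _ _ weyl_exp] arg_cong2[of _ _ _ _ bivec], auto simp: lins zero_prod_def)
  also have "weyl_exp (bivec j1 (\<lambda>v. j2 v + j3 v)) (weyl_exp ?P23 ?T) =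
      weyl_exp (\<lambda>f. bivec j1 (\<lambda>v. j2 v + j3 v) f + ?P23 f) ?T"
    by (rule weyl_exp_plus[symmetric]) (auto intro: bivec_commute)
  also have "\<dots> = weyl_exp (\<lambda>f. ?P12 f + ?P13 f + ?P23 f) ?T"
    by (rule weyl_exp_cong) (auto simp: bivec_add_right)
  also have "fps_pullback D (fps_pullback D23 \<dots>) = fps_pullback (\<lambda>x. (x, x, x)) \<dots>"
    unfolding fps_pullback_pullback by (rule arg_cong2[of _ _ _ _ fps_pullback]) (auto simp: lins)
  finally have right: "F \<star> (G \<star> H) = \<dots>" .
  show ?thesis
    unfolding left right ..
qed

lemma star_add_left:
  "F \<in> poly_exp_fps \<Longrightarrow> G \<in> poly_exp_fps \<Longrightarrow> H \<in> poly_exp_fps \<Longrightarrow> (F + G) \<star> H = F \<star> H + G \<star> H"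
  by (simp add: star_eq_weyl_exp poly_exp_fps_add fps_pullback_add distrib_right weyl_exp_add
      poly_exp_fps_mult fps_pullback_closed linear_fst linear_snd)

lemma star_add_right:
  "F \<in> poly_exp_fps \<Longrightarrow> G \<in> poly_exp_fps \<Longrightarrow> H \<in> poly_exp_fps \<Longrightarrow> F \<star> (G + H) = F \<star> G + F \<star> H"
  by (simp add: star_eq_weyl_exp poly_exp_fps_add fps_pullback_add distrib_left weyl_exp_add
      poly_exp_fps_mult fps_pullback_closed linear_fst linear_snd)

section \<open>Star products that reduce to pointwise products\<close>

lemma bivec_tensor:
  fixes f g :: "'n::finite obs"
  assumes "f \<in> poly_exp" "g \<in> poly_exp"
  shows "bivec (\<lambda>v. (v, 0)) (\<lambda>v. (0, v)) ((f \<circ> fst) * (g \<circ> snd)) =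
    (\<Sum>j\<in>UNIV. (dir_deriv (axis j 1, 0) f \<circ> fst) * (dir_deriv (0, axis j 1) g \<circ> snd)
       - (dir_deriv (0, axis j 1) f \<circ> fst) * (dir_deriv (axis j 1, 0) g \<circ> snd))"
proof -
  have d: "dir_deriv (v, 0) ((f \<circ> fst) * (g \<circ> snd)) = (dir_deriv v f \<circ> fst) * (g \<circ> snd)"
    "dir_deriv (0, v) ((f \<circ> fst) * (g \<circ> snd)) = (f \<circ> fst) * (dir_deriv v g \<circ> snd)"
    if "f \<in> poly_exp" "g \<in> poly_exp" for v and f g :: "'n obs"
    using that
    by (auto simp: poly_exp_dir_deriv_mult poly_exp_compose_linear linear_fst linear_snd
        dir_deriv_pullback_zero poly_exp_dir_deriv_compose_linear)
  show ?thesis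
    unfolding bivec_def using assms by (simp add: d poly_exp_dir_deriv)
qed

lemma weyl_exp_ident:
  assumes "\<And>m. B (fps_nth K m) = 0" "B 0 = 0"
  shows "weyl_exp B K = K"
proof (rule fps_ext)
  fix m
  have pow: "(B ^^ k) (fps_nth K i) = (if k = 0 then fps_nth K i else 0)" for k i
    by (induction k) (auto simp: assms simp del: zero_fun_apply)
  have "(\<Sum>k\<le>m. (\<lambda>_. (\<i> / 2) ^ k / fact k) * (B ^^ k) (fps_nth K (m - k))) =
      (\<Sum>k\<le>m. if k = 0 then fps_nth K m else 0)"
    unfolding pow by (rule sum.cong) (auto simp: fun_eq_iff)
  then show "fps_nth (weyl_exp B K) m = fps_nth K m"
    unfolding weyl_exp_def by simp
qed

text \<open>The operator has to annihilate the tensor products of the coefficients on the doubled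
  phase space, before restriction to the diagonal; then every higher power vanishes and the
  exponential acts as the identity.\<close>

lemma star_eq_mult:
  assumes "F \<in> poly_exp_fps" "G \<in> poly_exp_fps"
    and "\<And>a b. bivec (\<lambda>v. (v, 0)) (\<lambda>v. (0, v)) ((fps_nth F a \<circ> fst) * (fps_nth G b \<circ> snd)) = 0"
  shows "F \<star> G = F * G"
proof -
  have pe: "(fps_nth F a \<circ> fst) * (fps_nth G b \<circ> snd) \<in> poly_exp" for a b
    using assms(1,2)
    by (intro poly_exp.mult poly_exp_compose_linear linear_fst linear_snd poly_exp_fps_nth)
  have "bivec (\<lambda>v. (v, 0)) (\<lambda>v. (0, v)) (fps_nth (fps_pullback fst F * fps_pullback snd G) m) = 0" for m
    unfolding fps_mult_nth fps_pullback_def fps_nth_Abs_fps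
    by (subst bivec_sum) (auto simp only: pe assms(3) sum.neutral_const)
  then have "weyl_exp (bivec (\<lambda>v. (v, 0)) (\<lambda>v. (0, v))) (fps_pullback fst F * fps_pullback snd G) =
      fps_pullback fst F * fps_pullback snd G"
    by (intro weyl_exp_ident) auto
  then show ?thesis
    unfolding star_eq_weyl_exp[OF assms(1,2)] fps_pullback_mult
    by (simp add: fps_pullback_pullback comp_def fps_pullback_mult) (simp add: fps_pullback_def comp_def fps_nth_inverse)
qed

lemma fps_nth_star_const:
  assumes "f \<in> poly_exp" "g \<in> poly_exp"
  shows "fps_nth (fps_const f \<star> fps_const g) m = (\<lambda>x. (\<i> / 2) ^ m / fact m *
    (bivec (\<lambda>v. (v, 0)) (\<lambda>v. (0, v)) ^^ m) ((f \<circ> fst) * (g \<circ> snd)) (x, x))"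
proof -
  let ?B = "bivec (\<lambda>v. (v, 0)) (\<lambda>v. (0, v)) :: ('a phase \<times> 'a phase \<Rightarrow> complex) \<Rightarrow> _"
  have pb: "fps_pullback L (fps_const h) = fps_const (h \<circ> L)" for L :: "'a phase \<times> 'a phase \<Rightarrow> 'a phase" and h
    by (rule fps_ext) (auto simp: fps_pullback_def fun_eq_iff)
  have "(?B ^^ k) (fps_nth (fps_const T) (m - k)) = (if k = m then (?B ^^ m) T else 0)" if "k \<le> m" for k T
    using that poly_exp_op_zero[OF poly_exp_op_funpow[OF poly_exp_op_bivec]] by auto
  then have "fps_nth (weyl_exp ?B (fps_const T)) m =
      (\<Sum>k\<le>m. if k = m then (\<lambda>_. (\<i> / 2) ^ m / fact m) * (?B ^^ m) T else 0)" for T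
    unfolding weyl_exp_def fps_nth_Abs_fps
    by (intro sum.cong refl) (simp only: atMost_iff, simp del: times_fun_apply)
  then have "fps_nth (weyl_exp ?B (fps_const T)) m = (\<lambda>_. (\<i> / 2) ^ m / fact m) * (?B ^^ m) T" for T
    by simp
  then show ?thesis
    using assms by (simp add: star_eq_weyl_exp pb fps_const_mult[symmetric] del: fps_const_mult)
      (simp add: fps_pullback_def fun_eq_iff)
qed

definition fps_scalar :: "complex fps \<Rightarrow> 'n obs fps" where
  "fps_scalar c = Abs_fps (\<lambda>k. \<lambda>_. fps_nth c k)"

lemma fps_scalar_closed [simp]: "fps_scalar c \<in> (poly_exp_fps :: 'n::finite obs fps set)"
  by (simp add: fps_scalar_def poly_exp_fps_def poly_exp.const)

lemma fps_scalar_add: "fps_scalar (c + d) = fps_scalar c + fps_scalar d"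
  by (rule fps_ext) (simp add: fps_scalar_def fun_eq_iff)

lemma fps_scalar_mult: "fps_scalar (c * d) = fps_scalar c * fps_scalar d"
  by (rule fps_ext) (simp add: fps_scalar_def fun_eq_iff fps_mult_nth sum_fun_apply)

lemma fps_scalar_one: "fps_scalar 1 = 1"
  by (rule fps_ext) (simp add: fps_scalar_def fun_eq_iff)

lemma fps_nth_scalar: "fps_nth (fps_scalar c) k = (\<lambda>_. fps_nth c k)"
  by (simp add: fps_scalar_def)

lemma star_scalar_left:
  assumes "F \<in> poly_exp_fps"
  shows "fps_scalar c \<star> F = fps_scalar c * F"
  by (rule star_eq_mult[OF fps_scalar_closed assms], unfold fps_nth_scalar,
      subst bivec_tensor[OF poly_exp.const poly_exp_fps_nth[OF assms]])
    (simp add: fun_eq_iff sum_fun_apply)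

lemma star_scalar_right:
  assumes "F \<in> poly_exp_fps"
  shows "F \<star> fps_scalar c = F * fps_scalar c"
  by (rule star_eq_mult[OF assms fps_scalar_closed], unfold fps_nth_scalar,
      subst bivec_tensor[OF poly_exp_fps_nth[OF assms] poly_exp.const])
    (simp add: fun_eq_iff sum_fun_apply)

subsection \<open>The star algebra as a ring\<close>

text \<open>Associativity and distributivity have been shown for coefficients in
  \<open>poly_exp\<close>. A type for these series makes them ring axioms, so that matrix products,
  traces and rewriting in noncommutative rings become available.\<close>

typedef (overloaded) ('n::finite) qobs = "poly_exp_fps :: 'n obs fps set"
  by (rule exI[of _ 0]) (simp add: poly_exp_fps_def)

setup_lifting type_definition_qobs

instantiation qobs :: (finite) ring_1
begin

lift_definition zero_qobs :: "'a qobs" is 0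
  by (simp add: poly_exp_fps_def)

lift_definition one_qobs :: "'a qobs" is 1
  by (simp add: poly_exp_fps_def)

lift_definition plus_qobs :: "'a qobs \<Rightarrow> 'a qobs \<Rightarrow> 'a qobs" is "(+)"
  by (rule poly_exp_fps_add)

lift_definition uminus_qobs :: "'a qobs \<Rightarrow> 'a qobs" is uminus
  by (rule poly_exp_fps_uminus)

lift_definition minus_qobs :: "'a qobs \<Rightarrow> 'a qobs \<Rightarrow> 'a qobs" is "(-)"
  by (simp add: poly_exp_fps_def poly_exp_diff)

lift_definition times_qobs :: "'a qobs \<Rightarrow> 'a qobs \<Rightarrow> 'a qobs" is "(\<star>)"
  by (rule star_closed)

instance
proof
  fix a b c :: "'a qobs"
  show "a * b * c = a * (b * c)"
    by transfer (rule star_assoc)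
  show "1 * a = a"
    by transfer (use star_scalar_left[where c = 1] in \<open>simp add: fps_scalar_one\<close>)
  show "a * 1 = a"
    by transfer (use star_scalar_right[where c = 1] in \<open>simp add: fps_scalar_one\<close>)
  show "(a + b) * c = a * c + b * c"
    by transfer (rule star_add_left)
  show "a * (b + c) = a * b + a * c"
    by transfer (rule star_add_right)
  show "(0::'a qobs) \<noteq> 1"
    by transfer simp
qed (transfer; simp)+

end

section \<open>Scalar series and single functions as elements of the star algebra\<close>

lift_definition qscalar :: "complex fps \<Rightarrow> 'n::finite qobs" is fps_scalar
  by (rule fps_scalar_closed)

text \<open>A total function, for use on arbitrary evaluated coefficients; its representative is
  known for arguments in \<open>poly_exp\<close>, hence the side conditions of the lemmas
  below.\<close>

definition qfun :: "'n::finite obs \<Rightarrow> 'n qobs" where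
  "qfun f = Abs_qobs (fps_const f)"

lemma Rep_qfun: "f \<in> poly_exp \<Longrightarrow> Rep_qobs (qfun f) = fps_const f"
  by (simp add: qfun_def Abs_qobs_inverse)

lemma qfun_eqI: "f \<in> poly_exp \<Longrightarrow> Rep_qobs F = fps_const f \<Longrightarrow> F = qfun f"
  by (metis Rep_qfun Rep_qobs_inject)

lemma qscalar_add: "qscalar (c + d) = qscalar c + qscalar d"
  by transfer (rule fps_scalar_add)

lemma qscalar_mult: "qscalar (c * d) = qscalar c * qscalar d"
  by transfer (simp add: star_scalar_left fps_scalar_mult)

lemma qscalar_zero: "qscalar 0 = 0"
  by transfer (simp add: fps_scalar_def fps_eq_iff fun_eq_iff)

lemma qscalar_one: "qscalar 1 = 1"
  by transfer (rule fps_scalar_one)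

lemma qscalar_uminus: "qscalar (- c) = - qscalar c"
  by (metis add_eq_0_iff add.right_inverse qscalar_add qscalar_zero)

lemma qscalar_diff: "qscalar (c - d) = qscalar c - qscalar d"
  using qscalar_add[of c "- d"] by (simp add: qscalar_uminus)

lemma qscalar_commute: "qscalar c * F = F * qscalar c"
  by transfer (simp add: star_scalar_left star_scalar_right mult.commute)

lemma qfun_add: "f \<in> poly_exp \<Longrightarrow> g \<in> poly_exp \<Longrightarrow> qfun (f + g) = qfun f + qfun g"
  by (rule qfun_eqI[symmetric]) (auto simp: poly_exp.add plus_qobs.rep_eq Rep_qfun)

lemma qfun_zero: "qfun 0 = 0"
  by (rule qfun_eqI[symmetric]) (auto simp: zero_qobs.rep_eq)

lemma qfun_sum:
  "(\<And>i. i \<in> I \<Longrightarrow> f i \<in> poly_exp) \<Longrightarrow> qfun (sum f I) = (\<Sum>i\<in>I. qfun (f i))"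
  by (induction I rule: infinite_finite_induct) (auto simp: qfun_zero qfun_add poly_exp_sum)

lemma fps_scalar_const: "fps_scalar (fps_const c) = fps_const (\<lambda>_. c)"
  by (rule fps_ext) (auto simp: fps_scalar_def fun_eq_iff)

lemma qfun_cmult:
  assumes "f \<in> poly_exp"
  shows "qfun ((\<lambda>_. c) * f) = qscalar (fps_const c) * qfun f"
proof (rule qfun_eqI[symmetric])
  show "Rep_qobs (qscalar (fps_const c) * qfun f) = fps_const ((\<lambda>_. c) * f)"
    unfolding times_qobs.rep_eq qscalar.rep_eq Rep_qfun[OF assms]
      star_scalar_left[OF poly_exp_fps_const[OF assms]]
    by (simp add: fps_scalar_const)
qed (intro poly_exp.mult poly_exp.const assms)

lemma qfun_const: "qfun (\<lambda>_. c) = qscalar (fps_const c)"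
  by (rule qfun_eqI[symmetric])
    (auto simp: poly_exp.const qscalar.rep_eq fps_scalar_def fps_eq_iff fun_eq_iff)

lemma qfun_uminus: "f \<in> poly_exp \<Longrightarrow> qfun (- f) = - qfun f"
  by (rule qfun_eqI[symmetric]) (auto simp: uminus_qobs.rep_eq Rep_qfun)

lemma qfun_mult:
  assumes "f \<in> poly_exp" "g \<in> poly_exp"
    and "bivec (\<lambda>v. (v, 0)) (\<lambda>v. (0, v)) ((f \<circ> fst) * (g \<circ> snd)) = 0"
  shows "qfun f * qfun g = qfun (f * g)"
proof (rule qfun_eqI)
  have "bivec (\<lambda>v. (v, 0)) (\<lambda>v. (0, v)) ((fps_nth (fps_const f) a \<circ> fst) * (fps_nth (fps_const g) b \<circ> snd)) = 0" for a b
  proof (cases "a = 0 \<and> b = 0")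
    case False
    then have "(fps_nth (fps_const f) a \<circ> fst) * (fps_nth (fps_const g) b \<circ> snd) = 0"
      by (auto simp: fun_eq_iff)
    then show ?thesis by simp
  qed (use assms(3) in simp)
  then show "Rep_qobs (qfun f * qfun g) = fps_const (f * g)"
    using assms(1,2) by (simp add: times_qobs.rep_eq Rep_qfun star_eq_mult)
qed (use assms in \<open>simp add: poly_exp.mult\<close>)

text \<open>Dependence on the particles in S alone is expressed by vanishing partial derivatives,
  which is the form in which it meets the Poisson operator.\<close>

definition local_obs :: "'n set \<Rightarrow> 'n::finite obs set" where
  "local_obs S = {f \<in> poly_exp. \<forall>j. j \<notin> S \<longrightarrow>
     dir_deriv (axis j 1, 0) f = 0 \<and> dir_deriv (0, axis j 1) f = 0}"

lemma local_obs_poly_exp: "f \<in> local_obs S \<Longrightarrow> f \<in> poly_exp"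
  by (simp add: local_obs_def)

lemma local_obs_mono: "S \<subseteq> T \<Longrightarrow> local_obs S \<subseteq> local_obs T"
  by (auto simp: local_obs_def)

lemma local_obs_const [simp]: "(\<lambda>_. c) \<in> local_obs S"
  by (simp add: local_obs_def poly_exp.const)

lemma local_obs_zero [simp]: "0 \<in> local_obs S"
  unfolding zero_fun_def by simp

lemma local_obs_one [simp]: "1 \<in> local_obs S"
  unfolding one_fun_def by simp

lemma local_obs_add: "f \<in> local_obs S \<Longrightarrow> g \<in> local_obs S \<Longrightarrow> f + g \<in> local_obs S"
  by (simp add: local_obs_def poly_exp.add poly_exp_dir_deriv_add)

lemma local_obs_mult: "f \<in> local_obs S \<Longrightarrow> g \<in> local_obs S \<Longrightarrow> f * g \<in> local_obs S"
  by (simp add: local_obs_def poly_exp.mult poly_exp_dir_deriv_mult)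

lemma local_obs_uminus: "f \<in> local_obs S \<Longrightarrow> - f \<in> local_obs S"
  by (simp add: local_obs_def poly_exp_dir_deriv_uminus)

lemma local_obs_diff: "f \<in> local_obs S \<Longrightarrow> g \<in> local_obs S \<Longrightarrow> f - g \<in> local_obs S"
  using local_obs_add[of f S "- g"] by (simp add: local_obs_uminus)

lemma local_obs_sum: "(\<And>i. i \<in> I \<Longrightarrow> f i \<in> local_obs S) \<Longrightarrow> sum f I \<in> local_obs S"
  by (induction I rule: infinite_finite_induct) (auto intro: local_obs_add)

text \<open>Every summand of the Poisson operator differentiates both factors with respect to the
  same particle, and no particle belongs to both S and T.\<close>

lemma qfun_mult_local:
  assumes "f \<in> local_obs S" "g \<in> local_obs T" "S \<inter> T = {}"
  shows "qfun f * qfun g = qfun (f * g)"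
proof (rule qfun_mult)
  show "f \<in> poly_exp" "g \<in> poly_exp"
    using assms by (auto simp: local_obs_def)
  have "(dir_deriv (axis j 1, 0) f = 0 \<and> dir_deriv (0, axis j 1) f = 0) \<or>
      (dir_deriv (axis j 1, 0) g = 0 \<and> dir_deriv (0, axis j 1) g = 0)" for j
    using assms by (auto simp: local_obs_def)
  then have "(dir_deriv (axis j 1, 0) f \<circ> fst) * (dir_deriv (0, axis j 1) g \<circ> snd)
      - (dir_deriv (0, axis j 1) f \<circ> fst) * (dir_deriv (axis j 1, 0) g \<circ> snd) = 0" for j
    by (elim allE[of _ j] disjE meta_allE[of _ j]) (auto simp: fun_eq_iff)
  then show "bivec (\<lambda>v. (v, 0)) (\<lambda>v. (0, v)) ((f \<circ> fst) * (g \<circ> snd)) = 0"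
    unfolding bivec_tensor[OF \<open>f \<in> poly_exp\<close> \<open>g \<in> poly_exp\<close>]
    by (simp only: sum.neutral_const)
qed

section \<open>Star products with momenta and of exponentials\<close>

lemma linear_p_coord [simp]: "linear (p_coord j)"
  by (auto simp: linear_iff p_coord_def scaleR_conv_of_real[where 'a = complex])

lemma poly_exp_p_coord [simp]: "p_coord j \<in> poly_exp"
  by (simp add: poly_exp.linear)

lemma dir_deriv_p_coord: "dir_deriv v (p_coord j) = (\<lambda>_. complex_of_real (snd v $ j))"
  using dir_deriv_linear[OF linear_p_coord] by (simp add: p_coord_def)

abbreviation half_i_hbar :: "complex fps" where
  "half_i_hbar \<equiv> fps_const (\<i> / 2) * fps_X"

lemma bivec_p_coord:
  fixes g :: "'n::finite obs"
  assumes "g \<in> poly_exp"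
  shows "bivec (\<lambda>v. (v, 0)) (\<lambda>v. (0, v)) ((p_coord j \<circ> fst) * (g \<circ> snd)) =
      - (dir_deriv (axis j 1, 0) g \<circ> snd)" (is ?thesis1)
    and "bivec (\<lambda>v. (v, 0)) (\<lambda>v. (0, v)) ((g \<circ> fst) * (p_coord j \<circ> snd)) =
      dir_deriv (axis j 1, 0) g \<circ> fst" (is ?thesis2)
proof -
  have ax: "complex_of_real (axis i 1 $ j) * c = (if i = j then c else 0)"
    "c * complex_of_real (axis i 1 $ j) = (if i = j then c else 0)" for i j :: 'n and c
    by (simp_all add: axis_def)
  show ?thesis1 ?thesis2
    unfolding bivec_tensor[OF poly_exp_p_coord assms] bivec_tensor[OF assms poly_exp_p_coord]
    by (auto simp: dir_deriv_p_coord fun_eq_iff sum_fun_apply ax sum_negf)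
qed

text \<open>Each term of the operator differentiates once in each copy, so it kills a function of
  one copy only.\<close>

lemma bivec_pullback_fst_snd:
  fixes g :: "'n::finite obs"
  assumes "g \<in> poly_exp"
  shows "bivec (\<lambda>v. (v, 0)) (\<lambda>v. (0, v)) (g \<circ> fst) = 0"
    and "bivec (\<lambda>v. (v, 0)) (\<lambda>v. (0, v)) (g \<circ> snd) = 0"
proof -
  have 1: "g \<circ> fst = (g \<circ> fst) * ((\<lambda>_. 1) \<circ> snd)" and 2: "g \<circ> snd = ((\<lambda>_. 1) \<circ> fst) * (g \<circ> snd)"
    by (auto simp: fun_eq_iff)
  show "bivec (\<lambda>v. (v, 0)) (\<lambda>v. (0, v)) (g \<circ> fst) = 0"
    by (subst 1, subst bivec_tensor[OF assms poly_exp.const]) (auto simp: fun_eq_iff sum_fun_apply)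
  show "bivec (\<lambda>v. (v, 0)) (\<lambda>v. (0, v)) (g \<circ> snd) = 0"
    by (subst 2, subst bivec_tensor[OF poly_exp.const assms]) (auto simp: fun_eq_iff sum_fun_apply)
qed

text \<open>A second application of the Poisson operator gives zero, hence the exponential series
  stops after the term of order \<hbar>, whose restriction to the diagonal is h.\<close>

lemma qfun_mult_nilpotent:
  fixes f g h :: "'n::finite obs"
  assumes "f \<in> poly_exp" "g \<in> poly_exp" "h \<in> poly_exp"
    and "bivec (\<lambda>v. (v, 0)) (\<lambda>v. (0, v)) ((f \<circ> fst) * (g \<circ> snd)) = K"
    and "bivec (\<lambda>v. (v, 0)) (\<lambda>v. (0, v)) K = 0" "\<And>x. K (x, x) = h x"
  shows "qfun f * qfun g = qfun (f * g) + qscalar half_i_hbar * qfun h"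
proof -
  let ?B = "bivec (\<lambda>v. (v, 0)) (\<lambda>v. (0, v)) :: ('n phase \<times> 'n phase \<Rightarrow> complex) \<Rightarrow> _"
  have "(?B ^^ m) 0 = 0" for m
    by (rule poly_exp_op_zero) simp
  then have "(?B ^^ Suc (Suc m)) ((f \<circ> fst) * (g \<circ> snd)) = 0" for m
    unfolding funpow_Suc_right comp_apply assms(4,5) by simp
  note B = this
  have X: "fps_scalar half_i_hbar = fps_const (\<lambda>_. \<i> / 2) * fps_X"
    by (rule fps_ext) (auto simp: fps_scalar_def fun_eq_iff)
  have "fps_const f \<star> fps_const g = fps_const (f * g) + fps_scalar half_i_hbar * fps_const h"
  proof (rule fps_ext)
    fix m
    consider "m = 0" | "m = 1" | k where "m = Suc (Suc k)"
      by (metis One_nat_def not0_implies_Suc)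
    then show "fps_nth (fps_const f \<star> fps_const g) m =
        fps_nth (fps_const (f * g) + fps_scalar half_i_hbar * fps_const h) m"
      unfolding fps_nth_star_const[OF assms(1,2)] X
    proof cases
      case (3 k)
      then show "(\<lambda>x. (\<i> / 2) ^ m / fact m * (?B ^^ m) ((f \<circ> fst) * (g \<circ> snd)) (x, x)) =
          fps_nth (fps_const (f * g) + fps_const (\<lambda>_. \<i> / 2) * fps_X * fps_const h) m"
        unfolding 3 B by (auto simp: fun_eq_iff mult.assoc)
    qed (auto simp: fun_eq_iff assms(4,6) mult.assoc)
  qed
  then have "Rep_qobs (qfun f * qfun g) = Rep_qobs (qfun (f * g) + qscalar half_i_hbar * qfun h)"
    using assms(1-3)
    by (simp add: times_qobs.rep_eq plus_qobs.rep_eq qscalar.rep_eq Rep_qfun poly_exp.mult star_scalar_left)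
  then show ?thesis
    by (simp add: Rep_qobs_inject)
qed

text \<open>A momentum is linear, so the series stops at first order. Subtracting the two formulas
  gives the commutator of the j-th momentum with g as -\<i>\<hbar> times the derivative of g in the
  j-th position.\<close>

lemma qfun_p_coord_mult:
  fixes g :: "'n::finite obs"
  assumes "g \<in> poly_exp"
  shows "qfun (p_coord j) * qfun g = qfun (p_coord j * g) - qscalar half_i_hbar * qfun (dir_deriv (axis j 1, 0) g)"
    and "qfun g * qfun (p_coord j) = qfun (g * p_coord j) + qscalar half_i_hbar * qfun (dir_deriv (axis j 1, 0) g)"
proof -
  let ?h = "dir_deriv (axis j 1, 0) g"
  have h: "?h \<in> poly_exp"
    by (rule poly_exp_dir_deriv[OF assms])
  have "bivec (\<lambda>v. (v, 0)) (\<lambda>v. (0, v)) (- (?h \<circ> snd)) = 0"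
    using bivec_pullback_fst_snd(2)[OF poly_exp_uminus[OF h]] by (simp add: fun_Compl_def comp_def)
  from qfun_mult_nilpotent[OF poly_exp_p_coord assms poly_exp_uminus[OF h] bivec_p_coord(1)[OF assms] this]
  show "qfun (p_coord j) * qfun g = qfun (p_coord j * g) - qscalar half_i_hbar * qfun ?h"
    by (simp add: qfun_uminus h)
  from qfun_mult_nilpotent[OF assms poly_exp_p_coord h bivec_p_coord(2)[OF assms] bivec_pullback_fst_snd(1)[OF h]]
  show "qfun g * qfun (p_coord j) = qfun (g * p_coord j) + qscalar half_i_hbar * qfun ?h"
    by simp
qed

text \<open>Up to scalars, all exponentials in the seven matrices have this form, with exponent
  pairs (1, 0), (-1, 0), (0, b) and (-1, b).\<close>

definition site_exp :: "'n::finite \<Rightarrow> complex \<Rightarrow> complex \<Rightarrow> 'n obs" where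
  "site_exp j a b = (\<lambda>x. exp (a * q_coord j x + b * p_coord j x))"

lemma linear_site: "linear (\<lambda>x. a * q_coord j x + b * p_coord j x)"
  by (auto simp: linear_iff q_coord_def p_coord_def scaleR_conv_of_real[where 'a = complex] algebra_simps)

lemma site_exp_poly_exp [simp]: "site_exp j a b \<in> poly_exp"
  unfolding site_exp_def by (rule poly_exp.exp[OF linear_site])

lemma dir_deriv_site_exp:
  "dir_deriv (u, w) (site_exp j a b) = (\<lambda>_. a * complex_of_real (u $ j) + b * complex_of_real (w $ j)) * site_exp j a b"
  unfolding site_exp_def
  by (subst dir_deriv_exp[OF linear_site]) (simp add: q_coord_def p_coord_def)

lemma site_exp_local: "site_exp j a b \<in> local_obs {j}"
  by (auto simp: local_obs_def dir_deriv_site_exp axis_def fun_eq_iff)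

lemma p_coord_local: "p_coord j \<in> local_obs {j}"
  by (auto simp: local_obs_def dir_deriv_p_coord axis_def fun_eq_iff)

lemma site_exp_mult: "site_exp j a b * site_exp j c d = site_exp j (a + c) (b + d)"
  by (simp add: site_exp_def fun_eq_iff exp_add[symmetric] algebra_simps)

lemma site_exp_zero: "site_exp j 0 0 = 1"
  by (simp add: site_exp_def fun_eq_iff)

text \<open>These are the Weyl relations: the tensor product of two such exponentials is an
  eigenfunction of the Poisson operator with eigenvalue a d - b c, so the formal exponential acts on
  it as a scalar.\<close>

lemma qfun_site_exp_mult:
  fixes j :: "'n::finite"
  shows "qfun (site_exp j a b) * qfun (site_exp j c d) =
    qscalar (fps_exp (\<i> / 2 * (a * d - b * c))) * qfun (site_exp j (a + c) (b + d))"
proof -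
  let ?B = "bivec (\<lambda>v. (v, 0)) (\<lambda>v. (0, v)) :: ('n phase \<times> 'n phase \<Rightarrow> complex) \<Rightarrow> _"
  let ?T = "(site_exp j a b \<circ> fst) * (site_exp j c d \<circ> snd)" and ?w = "a * d - b * c"
  have D: "dir_deriv (axis i 1, 0) (site_exp j a b) x = (if i = j then a * site_exp j a b x else 0)"
      "dir_deriv (0, axis i 1) (site_exp j a b) x = (if i = j then b * site_exp j a b x else 0)" for i a b x
    by (simp_all add: dir_deriv_site_exp axis_def)
  have if_mult: "(if P then u else 0) * (if P then w else 0) = (if P then u * w else 0)" for P and u w :: complex
    by simp
  have T: "?T \<in> poly_exp"
    by (intro poly_exp.mult poly_exp_compose_linear linear_fst linear_snd site_exp_poly_exp)
  have B1: "?B ?T = (\<lambda>_. ?w) * ?T"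
    unfolding bivec_tensor[OF site_exp_poly_exp site_exp_poly_exp]
    by (simp add: D if_mult fun_eq_iff sum_fun_apply sum_subtractf algebra_simps)
  have B: "(?B ^^ m) ?T = (\<lambda>_. ?w ^ m) * ?T" for m
  proof (induction m)
    case (Suc m)
    show ?case
      unfolding funpow.simps comp_apply[of ?B] Suc bivec_cmult[OF T] B1 by (auto simp: fun_eq_iff)
  qed (auto simp: fun_eq_iff)
  have "fps_const (site_exp j a b) \<star> fps_const (site_exp j c d) =
      fps_scalar (fps_exp (\<i> / 2 * ?w)) * fps_const (site_exp j (a + c) (b + d))"
    by (rule fps_ext)
      (auto simp: fps_nth_star_const B fps_nth_scalar fun_eq_iff site_exp_mult[symmetric] power_mult_distrib power_divide)
  then have "Rep_qobs (qfun (site_exp j a b) * qfun (site_exp j c d)) =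
      Rep_qobs (qscalar (fps_exp (\<i> / 2 * ?w)) * qfun (site_exp j (a + c) (b + d)))"
    by (simp add: times_qobs.rep_eq qscalar.rep_eq Rep_qfun star_scalar_left)
  then show ?thesis
    by (simp add: Rep_qobs_inject)
qed

subsection \<open>RTT relations\<close>

text \<open>
  With the usual notation \<open>T\<^sub>1 = T \<otimes> 1\<close> and \<open>S\<^sub>2 = 1 \<otimes> S\<close>, these are \<open>T\<^sub>1 S\<^sub>2\<close> and \<open>S\<^sub>2 T\<^sub>1\<close>, which differ over a
  noncommutative ring.
\<close>

definition kron :: "'a::semiring_1 ^ 'm ^ 'm \<Rightarrow> 'a ^ 'm ^ 'm \<Rightarrow> 'a ^ ('m \<times> 'm) ^ ('m \<times> 'm)" where
  "kron T S = (\<chi> r c. T $ fst r $ fst c * S $ snd r $ snd c)"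

definition kron_op :: "'a::semiring_1 ^ 'm ^ 'm \<Rightarrow> 'a ^ 'm ^ 'm \<Rightarrow> 'a ^ ('m \<times> 'm) ^ ('m \<times> 'm)" where
  "kron_op T S = (\<chi> r c. S $ snd r $ snd c * T $ fst r $ fst c)"

lemma sum_pair_UNIV: "(\<Sum>r\<in>UNIV. f r) = (\<Sum>i\<in>UNIV. \<Sum>j\<in>UNIV. f (i, j))"
  by (simp add: UNIV_Times_UNIV[symmetric] sum.cartesian_product del: UNIV_Times_UNIV)

text \<open>Rearranging L T L' T' into L L' T T' needs a single exchange, that of T with L'; the
  opposite product below needs that of T' with L.\<close>

lemma kron_mult:
  fixes L T L' T' :: "'a::semiring_1 ^ 'm::finite ^ 'm"
  assumes "\<And>i j k l. T $ i $ j * L' $ k $ l = L' $ k $ l * T $ i $ j"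
  shows "kron (L ** T) (L' ** T') = kron L L' ** kron T T'"
proof -
  have c: "L $ i $ x * T $ x $ j * (L' $ k $ y * T' $ y $ l) = L $ i $ x * L' $ k $ y * (T $ x $ j * T' $ y $ l)"
    for i j k l x y
    using assms[of x j k y] by (metis mult.assoc)
  show ?thesis
    by (simp add: kron_def matrix_matrix_mult_def vec_eq_iff sum_pair_UNIV sum_product c)
qed

lemma kron_op_mult:
  fixes L T L' T' :: "'a::semiring_1 ^ 'm::finite ^ 'm"
  assumes "\<And>i j k l. T' $ i $ j * L $ k $ l = L $ k $ l * T' $ i $ j"
  shows "kron_op (L ** T) (L' ** T') = kron_op L L' ** kron_op T T'"
proof -
  have c: "L' $ k $ y * T' $ y $ l * (L $ i $ x * T $ x $ j) = L' $ k $ y * L $ i $ x * (T' $ y $ l * T $ x $ j)"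
    for i j k l x y
    using assms[of y l i x] by (metis mult.assoc)
  show ?thesis
    by (simp add: kron_op_def matrix_matrix_mult_def vec_eq_iff sum_pair_UNIV sum_product c)
      (intro allI sum.swap)
qed

lemma trace_kron: "trace (kron T S) = trace T * trace S"
  by (simp add: trace_def kron_def sum_pair_UNIV sum_product)

lemma trace_kron_op: "trace (kron_op T S) = trace S * trace T"
  unfolding trace_def kron_op_def sum_pair_UNIV sum_product by simp (rule sum.swap)

text \<open>Cyclicity of the trace fails over a noncommutative ring in general; it survives when the
  entries of one factor are central.\<close>

lemma trace_mult_central:
  fixes R M :: "'a::semiring_1 ^ 'm::finite ^ 'm"
  assumes "\<And>i j x. R $ i $ j * x = x * R $ i $ j"
  shows "trace (R ** M) = trace (M ** R)"
  unfolding trace_def matrix_matrix_mult_def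
  by (simp add: assms[of _ _ "M $ _ $ _"]) (rule sum.swap)

definition rtt :: "'a::semiring_1 ^ ('m \<times> 'm) ^ ('m \<times> 'm) \<Rightarrow> 'a ^ 'm ^ 'm \<Rightarrow> 'a ^ 'm ^ 'm \<Rightarrow> bool" where
  "rtt R T S \<longleftrightarrow> R ** kron T S = kron_op T S ** R"

text \<open>R is moved through the two factors one after the other, once each tensor square of a
  product has been split into a product of tensor squares. This is the comultiplication of the RTT
  algebra.\<close>

lemma rtt_mult:
  fixes R :: "'a::semiring_1 ^ ('m::finite \<times> 'm) ^ ('m \<times> 'm)"
  assumes "rtt R L L'" "rtt R T T'"
    and "\<And>i j k l. T $ i $ j * L' $ k $ l = L' $ k $ l * T $ i $ j"
    and "\<And>i j k l. T' $ i $ j * L $ k $ l = L $ k $ l * T' $ i $ j"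
  shows "rtt R (L ** T) (L' ** T')"
  using assms(1,2) unfolding rtt_def kron_mult[OF assms(3)] kron_op_mult[OF assms(4)]
  by (metis matrix_mul_assoc)

lemma rtt_one: "rtt (R :: 'a::semiring_1 ^ ('b::finite \<times> 'b) ^ ('b \<times> 'b)) (mat 1) (mat 1)"
proof -
  have "kron (mat 1) (mat 1) = (mat 1 :: 'a ^ ('b \<times> 'b) ^ ('b \<times> 'b))"
    "kron_op (mat 1) (mat 1) = (mat 1 :: 'a ^ ('b \<times> 'b) ^ ('b \<times> 'b))"
    by (auto simp: kron_def kron_op_def mat_def vec_eq_iff)
  then show ?thesis
    unfolding rtt_def by (simp only: matrix_mul_lid matrix_mul_rid)
qed

text \<open>The relation conjugates one ordering of the tensor product into the other by R, and
  conjugation by an invertible matrix with central entries in its inverse preserves the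
  trace.\<close>

lemma rtt_trace_commute:
  fixes R R' :: "'a::semiring_1 ^ ('m::finite \<times> 'm) ^ ('m \<times> 'm)"
  assumes "rtt R T S" "R' ** R = mat 1" "R ** R' = mat 1"
    and "\<And>i j x. R' $ i $ j * x = x * R' $ i $ j"
  shows "trace T * trace S = trace S * trace T"
proof -
  have "trace (kron T S) = trace (R' ** (kron_op T S ** R))"
    using assms(1,2) by (metis matrix_mul_assoc matrix_mul_lid rtt_def)
  also have "\<dots> = trace (kron_op T S)"
    using assms(3) by (simp add: trace_mult_central[OF assms(4)] matrix_mul_assoc[symmetric])
  finally show ?thesis
    by (simp add: trace_kron trace_kron_op)
qed

subsection \<open>Six-vertex R-matrices over the star algebra\<close>

text \<open>In the basis (1,1), (1,2), (2,1), (2,2) there is a two by two block between two corners.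
  Its four entries stay independent so that products and inverses remain in the family; the
  trigonometric R-matrix also has \<open>b\<^sub>2\<close> different from
  \<open>b\<^sub>1\<close>.\<close>

definition six_vertex :: "'a::zero \<Rightarrow> 'a \<Rightarrow> 'a \<Rightarrow> 'a \<Rightarrow> 'a \<Rightarrow> 'a ^ (2 \<times> 2) ^ (2 \<times> 2)" where
  "six_vertex a b\<^sub>1 c\<^sub>1 c\<^sub>2 b\<^sub>2 = (\<chi> r c.
     if r = c then (if fst r = snd r then a else if fst r = 1 then b\<^sub>1 else b\<^sub>2)
     else if r = (1, 2) \<and> c = (2, 1) then c\<^sub>1
     else if r = (2, 1) \<and> c = (1, 2) then c\<^sub>2 else 0)"

lemma six_vertex_mult:
  "six_vertex a b\<^sub>1 c\<^sub>1 c\<^sub>2 b\<^sub>2 ** six_vertex a' b\<^sub>1' c\<^sub>1' c\<^sub>2' b\<^sub>2' =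
   six_vertex (a * a') (b\<^sub>1 * b\<^sub>1' + c\<^sub>1 * c\<^sub>2') (b\<^sub>1 * c\<^sub>1' + c\<^sub>1 * b\<^sub>2') (c\<^sub>2 * b\<^sub>1' + b\<^sub>2 * c\<^sub>2') (c\<^sub>2 * c\<^sub>1' + b\<^sub>2 * b\<^sub>2')"
  for a :: "'a::semiring_1"
  by (simp add: matrix_matrix_mult_def six_vertex_def vec_eq_iff forall_2 sum_pair_UNIV sum_2)

lemma six_vertex_one: "six_vertex 1 1 0 0 (1::'a::zero_neq_one) = mat 1"
  by (simp add: mat_def six_vertex_def vec_eq_iff forall_2)

definition scalar_six_vertex ::
    "complex fps \<Rightarrow> complex fps \<Rightarrow> complex fps \<Rightarrow> complex fps \<Rightarrow> complex fps \<Rightarrow> 'n::finite qobs ^ (2 \<times> 2) ^ (2 \<times> 2)" where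
  "scalar_six_vertex a b\<^sub>1 c\<^sub>1 c\<^sub>2 b\<^sub>2 =
     six_vertex (qscalar a) (qscalar b\<^sub>1) (qscalar c\<^sub>1) (qscalar c\<^sub>2) (qscalar b\<^sub>2)"

lemma scalar_six_vertex_central:
  "scalar_six_vertex a b\<^sub>1 c\<^sub>1 c\<^sub>2 b\<^sub>2 $ i $ j * x = x * scalar_six_vertex a b\<^sub>1 c\<^sub>1 c\<^sub>2 b\<^sub>2 $ i $ j"
  by (simp add: scalar_six_vertex_def six_vertex_def qscalar_commute)

text \<open>Cramer's rule for the middle block. The corner and the determinant are units in
  \<complex>[[\<hbar>]] as soon as their constant terms are nonzero.\<close>

lemma scalar_six_vertex_inverse:
  assumes "fps_nth a 0 \<noteq> 0" "fps_nth (b\<^sub>1 * b\<^sub>2 - c\<^sub>1 * c\<^sub>2) 0 \<noteq> 0"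
  defines "\<delta> \<equiv> inverse (b\<^sub>1 * b\<^sub>2 - c\<^sub>1 * c\<^sub>2)"
  shows "scalar_six_vertex (inverse a) (\<delta> * b\<^sub>2) (- \<delta> * c\<^sub>1) (- \<delta> * c\<^sub>2) (\<delta> * b\<^sub>1) **
      (scalar_six_vertex a b\<^sub>1 c\<^sub>1 c\<^sub>2 b\<^sub>2 :: 'n::finite qobs ^ (2 \<times> 2) ^ (2 \<times> 2)) = mat 1" (is ?thesis1)
    and "(scalar_six_vertex a b\<^sub>1 c\<^sub>1 c\<^sub>2 b\<^sub>2 :: 'n qobs ^ (2 \<times> 2) ^ (2 \<times> 2)) **
      scalar_six_vertex (inverse a) (\<delta> * b\<^sub>2) (- \<delta> * c\<^sub>1) (- \<delta> * c\<^sub>2) (\<delta> * b\<^sub>1) = mat 1" (is ?thesis2)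
proof -
  have 1: "inverse a * a = 1"
    using assms(1) by (rule inverse_mult_eq_1)
  have 2: "\<delta> * (b\<^sub>1 * b\<^sub>2 - c\<^sub>1 * c\<^sub>2) = 1"
    unfolding \<delta>_def using assms(2) by (rule inverse_mult_eq_1)
  then have 3: "\<delta> * b\<^sub>2 * b\<^sub>1 + - \<delta> * c\<^sub>1 * c\<^sub>2 = 1" "\<delta> * b\<^sub>2 * c\<^sub>1 + - \<delta> * c\<^sub>1 * b\<^sub>2 = 0"
    "- \<delta> * c\<^sub>2 * b\<^sub>1 + \<delta> * b\<^sub>1 * c\<^sub>2 = 0" "- \<delta> * c\<^sub>2 * c\<^sub>1 + \<delta> * b\<^sub>1 * b\<^sub>2 = 1"
    "b\<^sub>1 * (\<delta> * b\<^sub>2) + c\<^sub>1 * (- \<delta> * c\<^sub>2) = 1" "b\<^sub>1 * (- \<delta> * c\<^sub>1) + c\<^sub>1 * (\<delta> * b\<^sub>1) = 0"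
    "c\<^sub>2 * (\<delta> * b\<^sub>2) + b\<^sub>2 * (- \<delta> * c\<^sub>2) = 0" "c\<^sub>2 * (- \<delta> * c\<^sub>1) + b\<^sub>2 * (\<delta> * b\<^sub>1) = 1"
    by (simp_all add: algebra_simps)
  show ?thesis1 ?thesis2
    unfolding scalar_six_vertex_def six_vertex_mult qscalar_mult[symmetric] qscalar_add[symmetric]
      3 1 1[unfolded mult.commute[of "inverse a"]] qscalar_one qscalar_zero six_vertex_one by simp_all
qed

text \<open>For the second claim, the first row and the first column of R contain nothing but the
  corner a, so the matching component of the relation has one term on each side, and a
  cancels.\<close>

lemma rtt_six_vertex_commute:
  fixes T S :: "'n::finite qobs ^ 2 ^ 2"
  assumes "rtt (scalar_six_vertex a b\<^sub>1 c\<^sub>1 c\<^sub>2 b\<^sub>2) T S"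
    and "fps_nth a 0 \<noteq> 0" "fps_nth (b\<^sub>1 * b\<^sub>2 - c\<^sub>1 * c\<^sub>2) 0 \<noteq> 0"
  shows "trace T * trace S = trace S * trace T"
    and "T $ 1 $ 1 * S $ 1 $ 1 = S $ 1 $ 1 * T $ 1 $ 1"
proof -
  show "trace T * trace S = trace S * trace T"
    using assms(1) scalar_six_vertex_inverse[OF assms(2,3)] scalar_six_vertex_central
    by (rule rtt_trace_commute)
  have "(scalar_six_vertex a b\<^sub>1 c\<^sub>1 c\<^sub>2 b\<^sub>2 ** kron T S) $ (1, 1) $ (1, 1) =
      (kron_op T S ** scalar_six_vertex a b\<^sub>1 c\<^sub>1 c\<^sub>2 b\<^sub>2) $ (1, 1) $ (1, 1)"
    using assms(1) by (simp add: rtt_def)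
  then have "qscalar a * (T $ 1 $ 1 * S $ 1 $ 1) = S $ 1 $ 1 * T $ 1 $ 1 * qscalar a"
    by (simp add: matrix_matrix_mult_def scalar_six_vertex_def six_vertex_def kron_def kron_op_def
        sum_pair_UNIV sum_2)
  also have "\<dots> = qscalar a * (S $ 1 $ 1 * T $ 1 $ 1)"
    by (rule qscalar_commute[symmetric])
  finally have "qscalar (inverse a) * qscalar a * (T $ 1 $ 1 * S $ 1 $ 1) =
      qscalar (inverse a) * qscalar a * (S $ 1 $ 1 * T $ 1 $ 1)"
    by (simp add: mult.assoc)
  then show "T $ 1 $ 1 * S $ 1 $ 1 = S $ 1 $ 1 * T $ 1 $ 1"
    using inverse_mult_eq_1[OF assms(2)] by (simp add: qscalar_mult[symmetric] qscalar_one)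
qed

text \<open>Keeping scalars in a separate operation gives a normal form in which they are collected
  in front, while the noncommuting generators keep their order.\<close>

definition qscale :: "complex fps \<Rightarrow> 'n::finite qobs \<Rightarrow> 'n qobs" where
  "qscale c F = qscalar c * F"

lemma qscale_simps:
  "qscale x F * G = qscale x (F * G)" "F * qscale x G = qscale x (F * G)"
  "qscale x (qscale y F) = qscale (x * y) F"
  "qscale x (F + G) = qscale x F + qscale x G" "qscale x (F - G) = qscale x F - qscale x G"
  "qscale x (- F) = - qscale x F"
  "qscale (x + y) F = qscale x F + qscale y F" "qscale (x - y) F = qscale x F - qscale y F"
  "qscale (- x) F = - qscale x F" "qscale 0 F = 0" "qscale x 0 = 0" "qscale 1 F = F"
proof -
  show "F * qscale x G = qscale x (F * G)"
    unfolding qscale_def by (metis mult.assoc qscalar_commute)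
qed (simp_all add: qscale_def qscalar_mult qscalar_add qscalar_diff qscalar_uminus qscalar_zero qscalar_one
    algebra_simps)

text \<open>The sixteen components of the matrix equation. Row and column indices (i, i) meet the
  corner a, the mixed indices (1, 2) and (2, 1) meet the block; scalars that stand on the right are
  moved to the front by centrality.\<close>

lemma rtt_scalar_six_vertexI:
  fixes T S :: "'n::finite qobs ^ 2 ^ 2"
  assumes "\<forall>i j. qscale a (T $ i $ j * S $ i $ j) = qscale a (S $ i $ j * T $ i $ j)"
    and "\<forall>i. qscale a (T $ i $ 1 * S $ i $ 2) = qscale b\<^sub>1 (S $ i $ 2 * T $ i $ 1) + qscale c\<^sub>2 (S $ i $ 1 * T $ i $ 2)"
    and "\<forall>i. qscale a (T $ i $ 2 * S $ i $ 1) = qscale c\<^sub>1 (S $ i $ 2 * T $ i $ 1) + qscale b\<^sub>2 (S $ i $ 1 * T $ i $ 2)"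
    and "\<forall>j. qscale b\<^sub>1 (T $ 1 $ j * S $ 2 $ j) + qscale c\<^sub>1 (T $ 2 $ j * S $ 1 $ j) = qscale a (S $ 2 $ j * T $ 1 $ j)"
    and "\<forall>j. qscale c\<^sub>2 (T $ 1 $ j * S $ 2 $ j) + qscale b\<^sub>2 (T $ 2 $ j * S $ 1 $ j) = qscale a (S $ 1 $ j * T $ 2 $ j)"
    and "qscale b\<^sub>1 (T $ 1 $ 1 * S $ 2 $ 2) + qscale c\<^sub>1 (T $ 2 $ 1 * S $ 1 $ 2) =
      qscale b\<^sub>1 (S $ 2 $ 2 * T $ 1 $ 1) + qscale c\<^sub>2 (S $ 2 $ 1 * T $ 1 $ 2)"
    and "qscale b\<^sub>1 (T $ 1 $ 2 * S $ 2 $ 1) + qscale c\<^sub>1 (T $ 2 $ 2 * S $ 1 $ 1) =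
      qscale c\<^sub>1 (S $ 2 $ 2 * T $ 1 $ 1) + qscale b\<^sub>2 (S $ 2 $ 1 * T $ 1 $ 2)"
    and "qscale c\<^sub>2 (T $ 1 $ 1 * S $ 2 $ 2) + qscale b\<^sub>2 (T $ 2 $ 1 * S $ 1 $ 2) =
      qscale b\<^sub>1 (S $ 1 $ 2 * T $ 2 $ 1) + qscale c\<^sub>2 (S $ 1 $ 1 * T $ 2 $ 2)"
    and "qscale c\<^sub>2 (T $ 1 $ 2 * S $ 2 $ 1) + qscale b\<^sub>2 (T $ 2 $ 2 * S $ 1 $ 1) =
      qscale c\<^sub>1 (S $ 1 $ 2 * T $ 2 $ 1) + qscale b\<^sub>2 (S $ 1 $ 1 * T $ 2 $ 2)"
  shows "rtt (scalar_six_vertex a b\<^sub>1 c\<^sub>1 c\<^sub>2 b\<^sub>2) T S"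
proof -
  have c: "F * qscalar x = qscale x F" for F :: "'n qobs" and x
    by (simp add: qscale_def qscalar_commute)
  show ?thesis
    unfolding rtt_def
    by (simp add: matrix_matrix_mult_def scalar_six_vertex_def six_vertex_def kron_def kron_op_def
        sum_pair_UNIV sum_2 vec_eq_iff forall_2 c qscale_def[symmetric])
      (intro conjI assms[rule_format])
qed

lemma mat2_nth [simp]:
  "mat2 a b c d $ 1 $ 1 = a" "mat2 a b c d $ 1 $ 2 = b" "mat2 a b c d $ 2 $ 1 = c" "mat2 a b c d $ 2 $ 2 = d"
  by (simp_all add: mat2_def)

text \<open>
  The hypotheses of the following two lemmas are rules for reordering the generators, so that both
  sides of each component of the RTT relation rewrite to the same normally ordered expression.
\<close>

lemma rtt_rational:
  fixes P B C :: "'n::finite qobs"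
  assumes PC: "P * C = C * P - qscale \<eta> C" and BP: "B * P = P * B - qscale \<eta> B"
    and BC: "B * C = C * B - qscale (\<eta> * d) 1"
  defines "L \<equiv> \<lambda>l. mat2 (P - qscale l 1) B C (qscale d 1)"
  shows "rtt (scalar_six_vertex (l - m + \<eta>) (l - m) \<eta> \<eta> (l - m)) (L l) (L m)"
proof -
  \<comment> \<open>Products are nested to the right during simplification, so each exchange rule is
    also needed with a trailing factor.\<close>
  have assoc: "P * (C * X) = C * (P * X) - qscale \<eta> (C * X)" "B * (P * X) = P * (B * X) - qscale \<eta> (B * X)"
     "B * (C * X) = C * (B * X) - qscale (\<eta> * d) X" for X
    by (simp_all add: mult.assoc[symmetric] PC BP BC)
       (simp_all add: qscale_simps algebra_simps)
  show ?thesis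
    by (rule rtt_scalar_six_vertexI)
      (simp_all add: L_def forall_2 qscale_simps PC BP BC assoc algebra_simps)
qed

text \<open>The R-matrix is normalised by the factor \<open>1/(\<lambda>\<mu>)\<close>; \<open>l'\<close> and \<open>m'\<close> stand for \<open>1/\<lambda>\<close> and \<open>1/\<mu>\<close>.\<close>

lemma rtt_trigonometric:
  fixes E B C :: "'n::finite qobs"
  assumes EC: "E * C = qscale v (C * E)" and BE: "B * E = qscale v (E * B)"
    and BC: "B * C = qscale v (C * B) + qscale ((1 - v) * d) 1"
    and inv: "l * l' = 1" "m * m' = 1"
  shows "rtt (scalar_six_vertex (v * l * m' - l' * m) (l * m' - l' * m) (v - 1) (v - 1) (v * (l * m' - l' * m)))
    (mat2 (qscale l' 1 - qscale l E) B C (qscale (l * d) 1))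
    (mat2 (qscale m' 1 - qscale m E) B C (qscale (m * d) 1))"
proof -
  have assoc: "E * (C * X) = qscale v (C * (E * X))" "B * (E * X) = qscale v (E * (B * X))"
     "B * (C * X) = qscale v (C * (B * X)) + qscale ((1 - v) * d) X" for X
    by (simp_all add: mult.assoc[symmetric] EC BE BC)
       (simp_all add: qscale_simps algebra_simps)
  have inv': "l * (l' * x) = x" "m * (m' * x) = x" for x
    by (simp_all add: mult.assoc[symmetric] inv)
  show ?thesis
    by (rule rtt_scalar_six_vertexI)
      (simp_all add: forall_2 qscale_simps EC BE BC assoc inv inv' algebra_simps)
qed

subsection \<open>Evaluation of Laurent polynomials\<close>

text \<open>At z = 0 negative powers take the default value 0, so multiplicativity is stated for
  nonzero z.\<close>

definition laurent_eval :: "complex \<Rightarrow> 'n laurent \<Rightarrow> 'n obs" where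
  "laurent_eval z X = (\<Sum>a\<in>Poly_Mapping.keys X. (\<lambda>_. z powi a) * Poly_Mapping.lookup X a)"

lemma laurent_eval_superset:
  assumes "finite K" "Poly_Mapping.keys X \<subseteq> K"
  shows "laurent_eval z X = (\<Sum>a\<in>K. (\<lambda>_. z powi a) * Poly_Mapping.lookup X a)"
proof -
  have "(\<lambda>_. z powi a) * Poly_Mapping.lookup X a = 0" if "a \<notin> Poly_Mapping.keys X" for a
    using that unfolding not_in_keys_iff_lookup_eq_zero by simp
  then show ?thesis
    unfolding laurent_eval_def using assms by (intro sum.mono_neutral_left) simp_all
qed

lemma laurent_eval_add: "laurent_eval z (X + Y) = laurent_eval z X + laurent_eval z Y"
  using keys_add[of X Y]
  by (simp add: laurent_eval_superset[of "Poly_Mapping.keys X \<union> Poly_Mapping.keys Y"]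
      lookup_add distrib_left sum.distrib)

lemma laurent_eval_zero [simp]: "laurent_eval z 0 = 0"
  by (simp add: laurent_eval_def)

lemma laurent_eval_uminus: "laurent_eval z (- X) = - laurent_eval z X"
  using laurent_eval_add[of z X "- X"] by (simp add: eq_neg_iff_add_eq_0 add.commute)

lemma laurent_eval_diff: "laurent_eval z (X - Y) = laurent_eval z X - laurent_eval z Y"
  using laurent_eval_add[of z X "- Y"] by (simp add: laurent_eval_uminus)

lemma laurent_eval_sum: "laurent_eval z (sum f I) = (\<Sum>i\<in>I. laurent_eval z (f i))"
  by (induction I rule: infinite_finite_induct) (auto simp: laurent_eval_add)

lemma laurent_eval_single: "laurent_eval z (Poly_Mapping.single a f) = (\<lambda>_. z powi a) * f"
  by (cases "f = 0") (simp_all add: laurent_eval_def fun_eq_iff)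

lemma laurent_decompose:
  "X = (\<Sum>a\<in>Poly_Mapping.keys X. Poly_Mapping.single a (Poly_Mapping.lookup X a))"
  by (rule poly_mapping_eqI) (auto simp: lookup_sum lookup_single when_def not_in_keys_iff_lookup_eq_zero)

lemma laurent_mult:
  fixes X Y :: "'n laurent"
  shows "X * Y = (\<Sum>a\<in>Poly_Mapping.keys X. \<Sum>b\<in>Poly_Mapping.keys Y.
    Poly_Mapping.single (a + b) (Poly_Mapping.lookup X a * Poly_Mapping.lookup Y b))"
proof -
  have "X * Y = (\<Sum>a\<in>Poly_Mapping.keys X. Poly_Mapping.single a (Poly_Mapping.lookup X a)) *
      (\<Sum>b\<in>Poly_Mapping.keys Y. Poly_Mapping.single b (Poly_Mapping.lookup Y b))"
    by (simp only: laurent_decompose[symmetric])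
  then show ?thesis
    by (simp add: sum_product mult_single)
qed

lemma laurent_eval_mult:
  assumes "z \<noteq> 0"
  shows "laurent_eval z (X * Y) = laurent_eval z X * laurent_eval z Y"
  unfolding laurent_mult laurent_eval_sum laurent_eval_single
  unfolding laurent_eval_def sum_product
  using assms by (intro sum.cong refl) (auto simp: fun_eq_iff power_int_add)

lemma laurent_eval_basics [simp]:
  "laurent_eval z lam = (\<lambda>_. z)" "laurent_eval z lam_inv = (\<lambda>_. inverse z)"
  "laurent_eval z (emb f) = f" "laurent_eval z 1 = 1"
  using laurent_eval_single[of z 0 1]
  by (auto simp: lam_def lam_inv_def emb_def laurent_eval_single fun_eq_iff power_int_minus)

definition laurent_over :: "'n obs set \<Rightarrow> 'n laurent set" where
  "laurent_over S = {X. \<forall>a. Poly_Mapping.lookup X a \<in> S}"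

lemma laurent_over_single: "f \<in> local_obs S \<Longrightarrow> Poly_Mapping.single a f \<in> laurent_over (local_obs S)"
  by (simp add: laurent_over_def lookup_single when_def)

lemma laurent_over_add:
  "X \<in> laurent_over (local_obs S) \<Longrightarrow> Y \<in> laurent_over (local_obs S) \<Longrightarrow> X + Y \<in> laurent_over (local_obs S)"
  by (simp add: laurent_over_def lookup_add local_obs_add)

lemma laurent_over_uminus: "X \<in> laurent_over (local_obs S) \<Longrightarrow> - X \<in> laurent_over (local_obs S)"
  by (simp add: laurent_over_def local_obs_uminus)

lemma laurent_over_diff:
  "X \<in> laurent_over (local_obs S) \<Longrightarrow> Y \<in> laurent_over (local_obs S) \<Longrightarrow> X - Y \<in> laurent_over (local_obs S)"
  by (simp add: laurent_over_def lookup_minus local_obs_diff)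

lemma laurent_over_zero: "0 \<in> laurent_over (local_obs S)"
  by (simp add: laurent_over_def)

lemma laurent_over_sum:
  "(\<And>i. i \<in> I \<Longrightarrow> f i \<in> laurent_over (local_obs S)) \<Longrightarrow> sum f I \<in> laurent_over (local_obs S)"
  by (induction I rule: infinite_finite_induct) (auto intro: laurent_over_add laurent_over_zero)

lemma laurent_over_mult:
  "X \<in> laurent_over (local_obs S) \<Longrightarrow> Y \<in> laurent_over (local_obs S) \<Longrightarrow> X * Y \<in> laurent_over (local_obs S)"
  unfolding laurent_mult
  by (intro laurent_over_sum laurent_over_single local_obs_mult) (simp_all add: laurent_over_def)

lemma laurent_over_basics:
  "lam \<in> laurent_over (local_obs S)" "lam_inv \<in> laurent_over (local_obs S)"
  "1 \<in> laurent_over (local_obs S)" "f \<in> local_obs S \<Longrightarrow> emb f \<in> laurent_over (local_obs S)"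
  using laurent_over_single[OF local_obs_one, of 0 S]
  by (simp_all add: lam_def lam_inv_def emb_def laurent_over_single)

lemma laurent_over_mono: "S \<subseteq> T \<Longrightarrow> laurent_over (local_obs S) \<subseteq> laurent_over (local_obs T)"
  using local_obs_mono unfolding laurent_over_def by blast

lemma laurent_over_eval: "X \<in> laurent_over (local_obs S) \<Longrightarrow> laurent_eval z X \<in> local_obs S"
  unfolding laurent_eval_def laurent_over_def
  by (intro local_obs_sum local_obs_mult local_obs_const) simp

lemma laurent_coeff_eq_0:
  fixes c :: "int \<Rightarrow> complex"
  assumes "finite K" "infinite Z" "0 \<notin> Z" "\<And>z. z \<in> Z \<Longrightarrow> (\<Sum>a\<in>K. z powi a * c a) = 0" "a \<in> K"
  shows "c a = 0"
proof -
  \<comment> \<open>A crude bound on all exponents: multiplication by the N-th power of z clears the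
    negative ones and leaves a polynomial.\<close>
  define N where "N = (\<Sum>a\<in>K. nat \<bar>a\<bar>)"
  have N: "0 \<le> a + int N" if "a \<in> K" for a
  proof -
    have "nat \<bar>a\<bar> \<le> N"
      unfolding N_def using that assms(1) by (intro member_le_sum) auto
    then show ?thesis by linarith
  qed
  define p where "p = (\<Sum>a\<in>K. monom (c a) (nat (a + int N)))"
  have "poly p z = 0" if "z \<in> Z" for z
  proof -
    have "z \<noteq> 0" using that assms(3) by blast
    have "poly p z = (\<Sum>a\<in>K. z ^ N * (z powi a * c a))"
      unfolding p_def poly_sum poly_monom
    proof (rule sum.cong)
      fix a assume "a \<in> K"
      then have "z ^ nat (a + int N) = z powi (a + int N)"
        using N by (simp add: power_int_def)
      also have "\<dots> = z powi a * z ^ N"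
        using \<open>z \<noteq> 0\<close> by (simp add: power_int_add)
      finally show "c a * z ^ nat (a + int N) = z ^ N * (z powi a * c a)" by simp
    qed simp
    also have "\<dots> = 0"
      using assms(4)[OF that] by (simp add: sum_distrib_left[symmetric])
    finally show ?thesis .
  qed
  then have "Z \<subseteq> {z. poly p z = 0}"
    by blast
  then have "p = 0"
    using assms(2) poly_roots_finite[of p] finite_subset by blast
  have "coeff p (nat (a + int N)) = (\<Sum>b\<in>K. if b = a then c b else 0)"
    unfolding p_def coeff_sum
  proof (rule sum.cong)
    fix b assume "b \<in> K"
    then show "coeff (monom (c b) (nat (b + int N))) (nat (a + int N)) = (if b = a then c b else 0)"
      using N[OF \<open>b \<in> K\<close>] N[OF assms(5)] by auto
  qed simp
  also have "\<dots> = c a"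
    using assms(1,5) by simp
  finally show ?thesis
    using \<open>p = 0\<close> by simp
qed

lemma qfun_laurent_eval:
  assumes "X \<in> laurent_over (local_obs S)"
  shows "qfun (laurent_eval z X) = (\<Sum>a\<in>Poly_Mapping.keys X. qscale (fps_const (z powi a)) (qfun (Poly_Mapping.lookup X a)))"
proof -
  have "Poly_Mapping.lookup X a \<in> poly_exp" for a
    using assms by (auto simp: laurent_over_def local_obs_def)
  then show ?thesis
    unfolding laurent_eval_def
    by (subst qfun_sum) (auto simp: qfun_cmult qscale_def intro: poly_exp.mult poly_exp.const)
qed

lemma fps_nth_Rep_qscale:
  "fps_nth (Rep_qobs (qscale (fps_const c) F)) k x = c * fps_nth (Rep_qobs F) k x"
proof -
  have "Rep_qobs (qscale (fps_const c) F) = fps_const (\<lambda>_. c) * Rep_qobs F"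
    unfolding qscale_def times_qobs.rep_eq qscalar.rep_eq star_scalar_left[OF Rep_qobs]
    by (simp add: fps_scalar_const)
  then show ?thesis by simp
qed

text \<open>The commutators of the coefficients are themselves the coefficients of a Laurent
  polynomial in l and m. It is eliminated one variable at a time: for fixed m all l outside {0, m,
  -m} are admissible, and afterwards m runs through all nonzero numbers.\<close>

lemma laurent_coeffs_commute:
  fixes X :: "'n::finite laurent"
  assumes X: "X \<in> laurent_over (local_obs S)"
    and "\<And>l m. l \<noteq> 0 \<Longrightarrow> m \<noteq> 0 \<Longrightarrow> l\<^sup>2 \<noteq> m\<^sup>2 \<Longrightarrow>
      qfun (laurent_eval l X) * qfun (laurent_eval m X) = qfun (laurent_eval m X) * qfun (laurent_eval l X)"
  shows "qfun (Poly_Mapping.lookup X a) * qfun (Poly_Mapping.lookup X b) =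
    qfun (Poly_Mapping.lookup X b) * qfun (Poly_Mapping.lookup X a)"
proof (cases "a \<in> Poly_Mapping.keys X \<and> b \<in> Poly_Mapping.keys X")
  case False
  then show ?thesis
    unfolding de_Morgan_conj not_in_keys_iff_lookup_eq_zero by (elim disjE) (simp_all add: qfun_zero)
next
  case True
  let ?K = "Poly_Mapping.keys X"
  define W where "W a b = qfun (Poly_Mapping.lookup X a) * qfun (Poly_Mapping.lookup X b) -
    qfun (Poly_Mapping.lookup X b) * qfun (Poly_Mapping.lookup X a)" for a b
  have W: "(\<Sum>a\<in>?K. \<Sum>b\<in>?K. qscale (fps_const (l powi a * m powi b)) (W a b)) = 0"
    if "l \<noteq> 0" "m \<noteq> 0" "l\<^sup>2 \<noteq> m\<^sup>2" for l m
  proof -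
    have "(\<Sum>a\<in>?K. \<Sum>b\<in>?K. qscale (fps_const (l powi a * m powi b))
        (qfun (Poly_Mapping.lookup X b) * qfun (Poly_Mapping.lookup X a))) =
      qfun (laurent_eval m X) * qfun (laurent_eval l X)"
      unfolding qfun_laurent_eval[OF X] sum_product
      by (subst sum.swap) (simp add: qscale_simps mult.commute)
    moreover have "(\<Sum>a\<in>?K. \<Sum>b\<in>?K. qscale (fps_const (l powi a * m powi b))
        (qfun (Poly_Mapping.lookup X a) * qfun (Poly_Mapping.lookup X b))) =
      qfun (laurent_eval l X) * qfun (laurent_eval m X)"
      unfolding qfun_laurent_eval[OF X] sum_product
      by (simp add: qscale_simps mult.commute)
    ultimately show ?thesis
      using assms(2)[OF that] by (simp add: W_def qscale_simps sum_subtractf)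
  qed
  have "fps_nth (Rep_qobs (W a b)) k x = 0" for k x
  proof -
    \<comment> \<open>Reading off one order in \<hbar> at one phase point is linear and turns the
      identity into one between complex numbers, to which the vanishing criterion applies.\<close>
    define \<phi> where "\<phi> F = fps_nth (Rep_qobs F) k x" for F :: "'n qobs"
    have add: "\<phi> (F + G) = \<phi> F + \<phi> G" for F G
      by (simp add: \<phi>_def plus_qobs.rep_eq)
    have zero: "\<phi> 0 = 0"
      by (simp add: \<phi>_def zero_qobs.rep_eq)
    have sum: "\<phi> (sum f I) = (\<Sum>i\<in>I. \<phi> (f i))" for f :: "int \<Rightarrow> _" and I
      by (induction I rule: infinite_finite_induct) (auto simp: add zero)
    have scale: "\<phi> (qscale (fps_const c) F) = c * \<phi> F" for c F
      by (simp add: \<phi>_def fps_nth_Rep_qscale)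
    have "(\<Sum>b\<in>?K. m powi b * \<phi> (W a b)) = 0" if "m \<noteq> 0" for m
    proof -
      have "infinite (UNIV - {0, m, - m} :: complex set)" "0 \<notin> UNIV - {0, m, - m}" "finite ?K"
        using infinite_UNIV_char_0 by (simp_all add: Diff_infinite_finite)
      moreover have "(\<Sum>a\<in>?K. l powi a * (\<Sum>b\<in>?K. m powi b * \<phi> (W a b))) = 0"
        if "l \<in> UNIV - {0, m, - m}" for l
      proof -
        have "l\<^sup>2 \<noteq> m\<^sup>2" "l \<noteq> 0"
          using that by (auto simp: power2_eq_iff)
        then have "\<phi> (\<Sum>a\<in>?K. \<Sum>b\<in>?K. qscale (fps_const (l powi a * m powi b)) (W a b)) = 0"
          using W \<open>m \<noteq> 0\<close> zero by simp
        then show ?thesis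
          by (simp add: sum scale sum_distrib_left mult.assoc)
      qed
      ultimately show ?thesis
        using laurent_coeff_eq_0[where c = "\<lambda>a. \<Sum>b\<in>?K. m powi b * \<phi> (W a b)" and a = a
            and K = ?K and Z = "UNIV - {0, m, - m}"] True
        by blast
    qed
    moreover have "infinite (UNIV - {0} :: complex set)" "(0::complex) \<notin> UNIV - {0}" "finite ?K"
      using infinite_UNIV_char_0 by (simp_all add: Diff_infinite_finite)
    ultimately have "\<phi> (W a b) = 0"
      using laurent_coeff_eq_0[where c = "\<lambda>b. \<phi> (W a b)" and a = b and K = ?K and Z = "UNIV - {0}"] True
      by blast
    then show ?thesis by (simp add: \<phi>_def)
  qed
  then have "Rep_qobs (W a b) = Rep_qobs 0"
    by (simp add: fps_eq_iff fun_eq_iff zero_qobs.rep_eq)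
  then show ?thesis
    by (simp add: Rep_qobs_inject W_def)
qed

subsection \<open>Monodromy matrices\<close>

definition qmat :: "complex \<Rightarrow> 'n::finite laurent ^ 2 ^ 2 \<Rightarrow> 'n qobs ^ 2 ^ 2" where
  "qmat z M = (\<chi> i j. qfun (laurent_eval z (M $ i $ j)))"

text \<open>This links the definition of the monodromy matrix by pointwise products to the star
  algebra: for factors on disjoint sets of particles both matrix products agree.\<close>

lemma qmat_mult:
  assumes "\<And>i j. L $ i $ j \<in> laurent_over (local_obs S)" "\<And>i j. M $ i $ j \<in> laurent_over (local_obs T)"
    and "S \<inter> T = {}" "z \<noteq> 0"
  shows "qmat z (L ** M) = qmat z L ** qmat z M"
proof -
  have "laurent_eval z (L $ i $ j) \<in> local_obs S" "laurent_eval z (M $ i $ j) \<in> local_obs T" for i j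
    using assms(1,2) by (auto intro: laurent_over_eval)
  note * = this local_obs_poly_exp[OF this(1)] local_obs_poly_exp[OF this(2)]
  show ?thesis
    by (simp add: qmat_def matrix_matrix_mult_def vec_eq_iff laurent_eval_sum laurent_eval_mult[OF assms(4)]
        qfun_sum poly_exp.mult * qfun_mult_local[OF *(1) *(2) assms(3)])
qed

text \<open>In either order the star product of the entries is the commutative pointwise product,
  whatever the two spectral parameters are.\<close>

lemma qmat_commute:
  assumes "\<And>i j. L $ i $ j \<in> laurent_over (local_obs S)" "\<And>i j. M $ i $ j \<in> laurent_over (local_obs T)"
    and "S \<inter> T = {}"
  shows "qmat z M $ i $ j * qmat w L $ k $ l = qmat w L $ k $ l * qmat z M $ i $ j"
proof -
  have 1: "laurent_eval w (L $ k $ l) \<in> local_obs S" "laurent_eval z (M $ i $ j) \<in> local_obs T"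
    using assms(1,2) by (auto intro: laurent_over_eval)
  have "T \<inter> S = {}" using assms(3) by blast
  then show ?thesis
    using qfun_mult_local[OF 1 assms(3)] qfun_mult_local[OF 1(2,1)] by (simp add: qmat_def mult.commute)
qed

lemma qmat_one: "qmat z (mat 1) = mat 1"
proof -
  have "qfun 1 = 1"
    unfolding one_fun_def qfun_const by (simp add: qscalar_one)
  then show ?thesis
    by (simp add: qmat_def mat_def vec_eq_iff qfun_zero)
qed

definition local_lax :: "'n::finite lax \<Rightarrow> bool" where
  "local_lax U \<longleftrightarrow> (\<forall>s i j. U (q_coord s) (p_coord s) $ i $ j \<in> laurent_over (local_obs {s}))"

text \<open>One R-matrix has to serve all sites.\<close>

definition rtt_lax :: "'n::finite lax \<Rightarrow> bool" where
  "rtt_lax U \<longleftrightarrow> (\<forall>l m. l \<noteq> 0 \<longrightarrow> m \<noteq> 0 \<longrightarrow> l\<^sup>2 \<noteq> m\<^sup>2 \<longrightarrow>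
     (\<exists>a b\<^sub>1 c\<^sub>1 c\<^sub>2 b\<^sub>2. fps_nth a 0 \<noteq> 0 \<and> fps_nth (b\<^sub>1 * b\<^sub>2 - c\<^sub>1 * c\<^sub>2) 0 \<noteq> 0 \<and>
       (\<forall>s. rtt (scalar_six_vertex a b\<^sub>1 c\<^sub>1 c\<^sub>2 b\<^sub>2)
         (qmat l (U (q_coord s) (p_coord s))) (qmat m (U (q_coord s) (p_coord s))))))"

lemma monodromy_local:
  assumes "local_lax U"
  shows "monodromy U e k $ i $ j \<in> laurent_over (local_obs (e ` {1..k}))"
proof (induction k arbitrary: i j)
  case 0
  show ?case by (simp add: mat_def laurent_over_zero laurent_over_basics)
next
  case (Suc k)
  have "monodromy U e k $ i $ j \<in> laurent_over (local_obs (e ` {1..Suc k}))" for i j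
    using Suc[of i j] laurent_over_mono[of "e ` {1..k}" "e ` {1..Suc k}"] by (auto simp: atLeastAtMostSuc_conv)
  moreover have "U (q_coord (e (Suc k))) (p_coord (e (Suc k))) $ i $ j \<in> laurent_over (local_obs (e ` {1..Suc k}))" for i j
    using assms laurent_over_mono[of "{e (Suc k)}" "e ` {1..Suc k}"] by (auto simp: local_lax_def)
  ultimately show ?case
    by (auto simp: matrix_matrix_mult_def intro!: laurent_over_sum laurent_over_mult)
qed

lemma monodromy_rtt:
  assumes "local_lax U" "inj_on e {1..n}" "l \<noteq> 0" "m \<noteq> 0"
    and "\<And>s. rtt R (qmat l (U (q_coord s) (p_coord s))) (qmat m (U (q_coord s) (p_coord s)))"
    and "k \<le> n"
  shows "rtt R (qmat l (monodromy U e k)) (qmat m (monodromy U e k))"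
  using assms(6)
proof (induction k)
  case 0
  then show ?case by (simp add: qmat_one rtt_one)
next
  case (Suc k)
  have L: "U (q_coord (e (Suc k))) (p_coord (e (Suc k))) $ i $ j \<in> laurent_over (local_obs {e (Suc k)})" for i j
    using assms(1) by (simp add: local_lax_def)
  note M = monodromy_local[OF assms(1), of e k]
  \<comment> \<open>Injectivity of the numbering makes the new site disjoint from all earlier
    ones.\<close>
  have "e (Suc k) \<noteq> e i" if "i \<in> {1..k}" for i
    using inj_onD[OF assms(2), of "Suc k" i] that Suc.prems by auto
  then have disj: "{e (Suc k)} \<inter> e ` {1..k} = {}"
    by blast
  show ?case
    unfolding monodromy.simps qmat_mult[OF L M disj assms(3)] qmat_mult[OF L M disj assms(4)]
    using assms(5) Suc by (intro rtt_mult qmat_commute[OF L M disj]) auto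
qed

lemma chi_coeffs_commute:
  assumes "local_lax U" "rtt_lax U" "inj_on e {1..n}" "X \<in> {chi U e n, chi_tilde U e n}"
  shows "X \<in> laurent_over (local_obs (e ` {1..n}))"
    and "qfun (Poly_Mapping.lookup X a) * qfun (Poly_Mapping.lookup X b) =
      qfun (Poly_Mapping.lookup X b) * qfun (Poly_Mapping.lookup X a)"
proof -
  let ?M = "monodromy U e n"
  note M = monodromy_local[OF assms(1), of e n]
  have chi: "chi U e n = ?M $ 1 $ 1 + ?M $ 2 $ 2" "chi_tilde U e n = ?M $ 1 $ 1"
    by (simp_all add: chi_def chi_tilde_def trace_def sum_2 matrix_matrix_mult_def)
  show X: "X \<in> laurent_over (local_obs (e ` {1..n}))"
    using assms(4) M by (auto simp: chi intro: laurent_over_add)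
  have "laurent_eval z (?M $ i $ j) \<in> poly_exp" for z i j
    using laurent_over_eval[OF M] by (rule local_obs_poly_exp)
  then have ev: "qfun (laurent_eval z (chi U e n)) = trace (qmat z ?M)"
    "qfun (laurent_eval z (chi_tilde U e n)) = qmat z ?M $ 1 $ 1" for z
    by (simp_all add: chi trace_def sum_2 qmat_def laurent_eval_add qfun_add)
  show "qfun (Poly_Mapping.lookup X a) * qfun (Poly_Mapping.lookup X b) =
      qfun (Poly_Mapping.lookup X b) * qfun (Poly_Mapping.lookup X a)"
  proof (rule laurent_coeffs_commute[OF X])
    fix l m :: complex
    assume lm: "l \<noteq> 0" "m \<noteq> 0" "l\<^sup>2 \<noteq> m\<^sup>2"
    then obtain a b\<^sub>1 c\<^sub>1 c\<^sub>2 b\<^sub>2 where R: "fps_nth a 0 \<noteq> 0" "fps_nth (b\<^sub>1 * b\<^sub>2 - c\<^sub>1 * c\<^sub>2) 0 \<noteq> 0"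
       "\<And>s. rtt (scalar_six_vertex a b\<^sub>1 c\<^sub>1 c\<^sub>2 b\<^sub>2)
         (qmat l (U (q_coord s) (p_coord s))) (qmat m (U (q_coord s) (p_coord s)))"
      using assms(2) unfolding rtt_lax_def by blast
    from rtt_six_vertex_commute[OF monodromy_rtt[OF assms(1,3) lm(1,2) R(3) order.refl] R(1,2)]
    show "qfun (laurent_eval l X) * qfun (laurent_eval m X) = qfun (laurent_eval m X) * qfun (laurent_eval l X)"
      using assms(4) ev by auto
  qed
qed

subsection \<open>The seven Lax matrices\<close>

lemma qfun_qscale: "f \<in> poly_exp \<Longrightarrow> qfun ((\<lambda>_. c) * f) = qscale (fps_const c) (qfun f)"
  by (simp add: qfun_cmult qscale_def)

lemma qfun_const_qscale: "qfun (\<lambda>_. c) = qscale (fps_const c) 1"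
  by (simp add: qfun_const qscale_def)

lemma qfun_diff: "f \<in> poly_exp \<Longrightarrow> g \<in> poly_exp \<Longrightarrow> qfun (f - g) = qfun f - qfun g"
  using qfun_add[of f "- g"] by (simp add: qfun_uminus)

lemma qmat_eq_mat2:
  assumes "laurent_eval z (M $ 1 $ 1) = f11" "laurent_eval z (M $ 1 $ 2) = f12"
    "laurent_eval z (M $ 2 $ 1) = f21" "laurent_eval z (M $ 2 $ 2) = f22"
  shows "qmat z M = mat2 (qfun f11) (qfun f12) (qfun f21) (qfun f22)"
  by (simp add: qmat_def vec_eq_iff forall_2 assms)

text \<open>The first two matrices differ in the pair (C, d), which is (exp q, 0) for one and (p exp
  q, -1) for the other. That C is an eigenfunction of the position derivative yields its commutator
  with the momentum; the relation between B and C has to be checked for each pair.\<close>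

lemma rtt_lax_rationalI:
  fixes U :: "'n::finite lax" and C :: "'n \<Rightarrow> 'n obs" and d :: complex
  assumes eval: "\<And>s z. z \<noteq> 0 \<Longrightarrow> laurent_eval z (U (q_coord s) (p_coord s) $ 1 $ 1) = p_coord s - (\<lambda>_. z)"
      "\<And>s z. z \<noteq> 0 \<Longrightarrow> laurent_eval z (U (q_coord s) (p_coord s) $ 1 $ 2) = - site_exp s (-1) 0"
      "\<And>s z. z \<noteq> 0 \<Longrightarrow> laurent_eval z (U (q_coord s) (p_coord s) $ 2 $ 1) = C s"
      "\<And>s z. z \<noteq> 0 \<Longrightarrow> laurent_eval z (U (q_coord s) (p_coord s) $ 2 $ 2) = (\<lambda>_. d)"
    and C: "\<And>s. C s \<in> poly_exp" "\<And>s. dir_deriv (axis s 1, 0) (C s) = C s"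
    and BC: "\<And>s. - qfun (site_exp s (-1) 0) * qfun (C s) =
      qfun (C s) * - qfun (site_exp s (-1) 0) - qscale ((half_i_hbar + half_i_hbar) * fps_const d) 1"
  shows "rtt_lax U"
  unfolding rtt_lax_def
proof (intro allI impI)
  fix l m :: complex
  assume lm: "l \<noteq> 0" "m \<noteq> 0" "l\<^sup>2 \<noteq> m\<^sup>2"
  \<comment> \<open>This is \<i>\<hbar>: each of the two orderings contributes one half to the
    commutator.\<close>
  let ?\<eta> = "half_i_hbar + half_i_hbar" and ?l = "fps_const l" and ?m = "fps_const m"
  have comm: "qfun (p_coord s) * qfun g = qfun g * qfun (p_coord s) - qscale ?\<eta> (qfun (dir_deriv (axis s 1, 0) g))"
    if "g \<in> poly_exp" for g s
    unfolding qfun_p_coord_mult[OF that] mult.commute[of g] qscale_def qscalar_add distrib_right by simp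
  have ds: "dir_deriv (axis s 1, 0) (site_exp s (-1) 0) = - site_exp s (-1) 0" for s
    by (simp add: dir_deriv_site_exp fun_eq_iff)
  have PB: "- qfun (site_exp s (-1) 0) * qfun (p_coord s) =
      qfun (p_coord s) * - qfun (site_exp s (-1) 0) - qscale ?\<eta> (- qfun (site_exp s (-1) 0))" for s
    using comm[OF site_exp_poly_exp, of s s "-1" 0] unfolding ds
    by (simp add: qfun_uminus qscale_simps(6))
  have PC: "qfun (p_coord s) * qfun (C s) = qfun (C s) * qfun (p_coord s) - qscale ?\<eta> (qfun (C s))" for s
    using comm[OF C(1), of s s] unfolding C(2) .
  have "rtt (scalar_six_vertex (?l - ?m + ?\<eta>) (?l - ?m) ?\<eta> ?\<eta> (?l - ?m))
         (qmat l (U (q_coord s) (p_coord s))) (qmat m (U (q_coord s) (p_coord s)))" for s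
    unfolding qmat_eq_mat2[OF eval[OF lm(1)]] qmat_eq_mat2[OF eval[OF lm(2)]]
    using rtt_rational[OF PC[of s] PB[of s] BC[of s], of ?l ?m]
    by (simp only: qfun_diff qfun_uminus qfun_const_qscale poly_exp.const poly_exp_p_coord site_exp_poly_exp)
  \<comment> \<open>At order zero \<eta> disappears, which leaves l - m and its square.\<close>
  moreover have "fps_nth (?l - ?m + ?\<eta>) 0 \<noteq> 0" "fps_nth ((?l - ?m) * (?l - ?m) - ?\<eta> * ?\<eta>) 0 \<noteq> 0"
    using lm by (auto simp: fps_mult_nth_0)
  ultimately show "\<exists>a b\<^sub>1 c\<^sub>1 c\<^sub>2 b\<^sub>2. fps_nth a 0 \<noteq> 0 \<and> fps_nth (b\<^sub>1 * b\<^sub>2 - c\<^sub>1 * c\<^sub>2) 0 \<noteq> 0 \<and>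
       (\<forall>s. rtt (scalar_six_vertex a b\<^sub>1 c\<^sub>1 c\<^sub>2 b\<^sub>2)
         (qmat l (U (q_coord s) (p_coord s))) (qmat m (U (q_coord s) (p_coord s))))"
    by blast
qed

text \<open>One family for the third to the seventh matrix. In B the part exp(-q + b p) exchanges
  with exp q up to the factor v, whereas exp(-q) and exp q are inverse to each other. Hence B C - v
  C B equals (1 - v) times \<open>\<beta>\<^sub>2 * \<gamma>\<close>, and this is the constant d
  that the entry (2,2) carries.\<close>

lemma rtt_lax_trigonometricI:
  fixes U :: "'n::finite lax" and b \<beta>\<^sub>1 \<beta>\<^sub>2 \<gamma> :: complex
  assumes eval: "\<And>s z. z \<noteq> 0 \<Longrightarrow> laurent_eval z (U (q_coord s) (p_coord s) $ 1 $ 1) =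
        (\<lambda>_. inverse z) - (\<lambda>_. z) * site_exp s 0 b"
      "\<And>s z. z \<noteq> 0 \<Longrightarrow> laurent_eval z (U (q_coord s) (p_coord s) $ 1 $ 2) =
        (\<lambda>_. \<beta>\<^sub>1) * site_exp s (-1) b + (\<lambda>_. \<beta>\<^sub>2) * site_exp s (-1) 0"
      "\<And>s z. z \<noteq> 0 \<Longrightarrow> laurent_eval z (U (q_coord s) (p_coord s) $ 2 $ 1) = (\<lambda>_. \<gamma>) * site_exp s 1 0"
      "\<And>s z. z \<noteq> 0 \<Longrightarrow> laurent_eval z (U (q_coord s) (p_coord s) $ 2 $ 2) = (\<lambda>_. z * (\<beta>\<^sub>2 * \<gamma>))"
  shows "rtt_lax U"
  unfolding rtt_lax_def
proof (intro allI impI)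
  fix l m :: complex
  assume lm: "l \<noteq> 0" "m \<noteq> 0" "l\<^sup>2 \<noteq> m\<^sup>2"
  \<comment> \<open>exp(b p) \<star> exp q carries the factor exp(-\<i>\<hbar>b/2) and the reversed
    product its inverse; v is their quotient.\<close>
  define v where "v = fps_exp (- \<i> * b)"
  let ?l = "fps_const l" and ?l' = "fps_const (inverse l)" and ?m = "fps_const m" and ?m' = "fps_const (inverse m)"
  define E B C where "E s = qfun (site_exp s 0 b)"
    and "B s = qscale (fps_const \<beta>\<^sub>1) (qfun (site_exp s (-1) b)) + qscale (fps_const \<beta>\<^sub>2) (qfun (site_exp s (-1) 0))"
    and "C s = qscale (fps_const \<gamma>) (qfun (site_exp s 1 0))" for s :: 'n
  have mult: "qfun (site_exp s x y) * qfun (site_exp s x' y') =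
      qscale (fps_exp (\<i> / 2 * (x * y' - y * x'))) (qfun (site_exp s (x + x') (y + y')))" for s :: 'n and x y x' y'
    by (simp add: qfun_site_exp_mult qscale_def)
  have w: "fps_exp (- \<i> * b) * fps_exp (\<i> / 2 * b) = (fps_exp (- (\<i> * b / 2)) :: complex fps)"
    by (simp add: fps_exp_add_mult[symmetric] field_simps)
  have one: "qfun (site_exp s 0 0) = 1" for s :: 'n
    by (simp add: site_exp_zero one_fun_def qfun_const qscalar_one)
  have EC: "E s * C s = qscale v (C s * E s)" for s
    using w by (simp add: E_def C_def v_def qscale_simps mult mult_ac)
  have BE: "B s * E s = qscale v (E s * B s)" for s
    using w by (simp add: E_def B_def v_def distrib_left distrib_right qscale_simps mult mult_ac)
  have BC: "B s * C s = qscale v (C s * B s) + qscale ((1 - v) * fps_const (\<beta>\<^sub>2 * \<gamma>)) 1" for s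
    using w by (simp add: C_def B_def v_def qscale_simps mult mult_ac one algebra_simps)
  have inv: "?l * ?l' = 1" "?m * ?m' = 1"
    using lm by simp_all
  have mat: "qmat z (U (q_coord s) (p_coord s)) = mat2 (qscale (fps_const (inverse z)) 1 - qscale (fps_const z) (E s))
      (B s) (C s) (qscale (fps_const z * fps_const (\<beta>\<^sub>2 * \<gamma>)) 1)" if "z \<noteq> 0" for z s
    unfolding qmat_eq_mat2[OF eval[OF that]] E_def B_def C_def fps_const_mult
    by (simp only: qfun_diff qfun_add qfun_qscale qfun_const_qscale poly_exp.const poly_exp.mult site_exp_poly_exp)
  have "rtt (scalar_six_vertex (v * ?l * ?m' - ?l' * ?m) (?l * ?m' - ?l' * ?m) (v - 1) (v - 1) (v * (?l * ?m' - ?l' * ?m)))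
         (qmat l (U (q_coord s) (p_coord s))) (qmat m (U (q_coord s) (p_coord s)))" for s
    unfolding mat[OF lm(1)] mat[OF lm(2)] by (rule rtt_trigonometric[OF EC BE BC inv])
  \<comment> \<open>Since v has constant term 1, the corner reduces to this number at order zero and
    the determinant to its square.\<close>
  moreover have "l / m - m / l \<noteq> 0"
    using lm by (auto simp: field_simps power2_eq_square)
  then have "fps_nth (v * ?l * ?m' - ?l' * ?m) 0 \<noteq> 0"
    "fps_nth ((?l * ?m' - ?l' * ?m) * (v * (?l * ?m' - ?l' * ?m)) - (v - 1) * (v - 1)) 0 \<noteq> 0"
    using lm by (auto simp: fps_mult_nth_0 v_def divide_inverse mult.commute)
  ultimately show "\<exists>a b\<^sub>1 c\<^sub>1 c\<^sub>2 b\<^sub>2. fps_nth a 0 \<noteq> 0 \<and> fps_nth (b\<^sub>1 * b\<^sub>2 - c\<^sub>1 * c\<^sub>2) 0 \<noteq> 0 \<and>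
       (\<forall>s. rtt (scalar_six_vertex a b\<^sub>1 c\<^sub>1 c\<^sub>2 b\<^sub>2)
         (qmat l (U (q_coord s) (p_coord s))) (qmat m (U (q_coord s) (p_coord s))))"
    by blast
qed

lemma expf_site_exp:
  "expf (q_coord s) = site_exp s 1 0" "expf (- q_coord s) = site_exp s (-1) 0"
  "expf (p_coord s) = site_exp s 0 1" "expf (p_coord s - q_coord s) = site_exp s (-1) 1"
  "expf ((\<lambda>_. c) * p_coord s) = site_exp s 0 c"
  by (auto simp: expf_def site_exp_def fun_eq_iff)

lemmas lax_defs = lax1_def lax2_def lax3_def lax4_def lax5_def lax6_def lax7_def

lemma local_lax_cases:
  assumes "U \<in> {lax1, lax2, lax3, lax4 g, lax5 g \<delta>, lax6 \<epsilon>, lax7 \<epsilon>}"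
  shows "local_lax U"
  using assms unfolding local_lax_def
  by (auto simp: forall_2 lax_defs expf_site_exp con_def
      intro!: laurent_over_add laurent_over_uminus laurent_over_diff laurent_over_mult laurent_over_basics
        laurent_over_zero local_obs_mult local_obs_add local_obs_diff site_exp_local p_coord_local local_obs_const)

lemmas laurent_eval_simps = laurent_eval_add laurent_eval_diff laurent_eval_uminus laurent_eval_mult

lemma rtt_lax_cases:
  assumes "U \<in> {lax1, lax2, lax3, lax4 g, lax5 g \<delta>, lax6 \<epsilon>, lax7 \<epsilon>}"
  shows "rtt_lax (U :: 'n::finite lax)"
proof -
  have B: "qfun (site_exp s (-1) 0) * qfun (site_exp s 1 0) = 1" "qfun (site_exp s 1 0) * qfun (site_exp s (-1) 0) = 1"
    for s :: 'n
    by (simp_all add: qfun_site_exp_mult site_exp_zero one_fun_def qfun_const qscalar_one)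
  have 1: "rtt_lax (lax1 :: 'n lax)"
  proof (rule rtt_lax_rationalI[where C = "\<lambda>s. site_exp s 1 0" and d = 0])
    show "dir_deriv (axis s 1, 0) (site_exp s 1 0) = site_exp s 1 0" for s :: 'n
      by (simp add: dir_deriv_site_exp fun_eq_iff)
  qed (simp_all add: lax1_def laurent_eval_simps expf_site_exp B qscale_simps fun_eq_iff)
  have 2: "rtt_lax (lax2 :: 'n lax)"
  proof (rule rtt_lax_rationalI[where C = "\<lambda>s. p_coord s * site_exp s 1 0" and d = "-1"])
    fix s :: 'n
    show "p_coord s * site_exp s 1 0 \<in> poly_exp"
      by (simp add: poly_exp.mult)
    show "dir_deriv (axis s 1, 0) (p_coord s * site_exp s 1 0) = p_coord s * site_exp s 1 0"
      by (simp add: poly_exp_dir_deriv_mult dir_deriv_p_coord dir_deriv_site_exp fun_eq_iff)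
    let ?P = "qfun (p_coord s)" and ?S = "qfun (site_exp s 1 0)" and ?S' = "qfun (site_exp s (-1) 0)"
    have ds: "dir_deriv (axis s 1, 0) (site_exp s 1 0) = site_exp s 1 0"
        "dir_deriv (axis s 1, 0) (site_exp s (-1) 0) = - site_exp s (-1) 0"
      by (simp_all add: dir_deriv_site_exp fun_eq_iff)
    \<comment> \<open>The pointwise product p exp q is the symmetrically ordered one; rewriting it
      as a star product costs half a commutator.\<close>
    have C: "qfun (p_coord s * site_exp s 1 0) = ?P * ?S + qscale half_i_hbar ?S"
      using qfun_p_coord_mult(1)[OF site_exp_poly_exp[of s 1 0], of s] by (simp add: ds qscale_def)
    have SP: "?S' * ?P = ?P * ?S' - qscale half_i_hbar ?S' - qscale half_i_hbar ?S'"
      using qfun_p_coord_mult[OF site_exp_poly_exp[of s "-1" 0], of s]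
      by (simp add: ds qscale_def qfun_uminus mult.commute[of "p_coord s"])
    have SPS: "?S' * (?P * ?S) = ?P - qscale half_i_hbar 1 - qscale half_i_hbar 1"
      unfolding mult.assoc[symmetric] SP by (simp add: left_diff_distrib mult.assoc qscale_simps B)
    have "(h + h) * fps_const (- 1) = - h - h" for h :: "complex fps"
      by (simp add: fps_const_neg[symmetric] del: fps_const_neg)
    then have h: "qscale ((h + h) * fps_const (- 1)) F = - qscale h F - qscale h F" for h and F :: "'n qobs"
      by (simp only: qscale_simps)
    show "- ?S' * qfun (p_coord s * site_exp s 1 0) = qfun (p_coord s * site_exp s 1 0) * - ?S' -
        qscale ((half_i_hbar + half_i_hbar) * fps_const (- 1)) 1"
      unfolding C h by (simp add: distrib_left distrib_right qscale_simps SPS mult.assoc B)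
  qed (simp_all add: lax2_def laurent_eval_simps expf_site_exp con_def fun_eq_iff)
  have 3: "rtt_lax (lax3 :: 'n lax)"
    by (rule rtt_lax_trigonometricI[where b = 1 and \<beta>\<^sub>1 = 0 and \<beta>\<^sub>2 = "-1" and \<gamma> = 1])
      (simp_all add: lax3_def laurent_eval_simps expf_site_exp con_def fun_eq_iff)
  have 4: "rtt_lax (lax4 g :: 'n lax)"
    by (rule rtt_lax_trigonometricI[where b = 1 and \<beta>\<^sub>1 = "- g\<^sup>2" and \<beta>\<^sub>2 = 0 and \<gamma> = 1])
      (simp_all add: lax4_def laurent_eval_simps expf_site_exp con_def fun_eq_iff)
  have 5: "rtt_lax (lax5 g \<delta> :: 'n lax)"
    by (rule rtt_lax_trigonometricI[where b = 1 and \<beta>\<^sub>1 = "- g\<^sup>2" and \<beta>\<^sub>2 = "- g\<^sup>2 * \<delta>" and \<gamma> = 1])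
      (simp_all add: lax5_def laurent_eval_simps expf_site_exp con_def site_exp_def exp_add[symmetric] fun_eq_iff algebra_simps)
  have 6: "rtt_lax (lax6 \<epsilon> :: 'n lax)"
    by (rule rtt_lax_trigonometricI[where b = \<epsilon> and \<beta>\<^sub>1 = 0 and \<beta>\<^sub>2 = "- \<epsilon>" and \<gamma> = \<epsilon>])
      (simp_all add: lax6_def laurent_eval_simps expf_site_exp con_def fun_eq_iff power2_eq_square)
  have 7: "rtt_lax (lax7 \<epsilon> :: 'n lax)"
    by (rule rtt_lax_trigonometricI[where b = \<epsilon> and \<beta>\<^sub>1 = "-1" and \<beta>\<^sub>2 = 1 and \<gamma> = \<epsilon>])
      (simp_all add: lax7_def laurent_eval_simps expf_site_exp con_def site_exp_def exp_add[symmetric] fun_eq_iff algebra_simps)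
  show ?thesis
    using assms 1 2 3 4 5 6 7 by blast
qed

subsection \<open>The leading coefficients for the Toda chain\<close>

lemma lookup_emb_mult: "Poly_Mapping.lookup (emb f * X) a = f * Poly_Mapping.lookup X a"
  and lookup_lam_mult: "Poly_Mapping.lookup (lam * X) a = Poly_Mapping.lookup X (a - 1)"
  for X :: "'n laurent"
proof -
  have single: "Poly_Mapping.lookup (Poly_Mapping.single b f * X) a = f * Poly_Mapping.lookup X (a - b)" for b f
  proof -
    have "Poly_Mapping.single b f * X =
        (\<Sum>c\<in>Poly_Mapping.keys X. Poly_Mapping.single (b + c) (f * Poly_Mapping.lookup X c))"
      by (subst laurent_decompose[of X]) (simp only: sum_distrib_left mult_single)
    then have "Poly_Mapping.lookup (Poly_Mapping.single b f * X) a =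
        (\<Sum>c\<in>Poly_Mapping.keys X. if c = a - b then f * Poly_Mapping.lookup X c else 0)"
      by (simp only: lookup_sum lookup_single when_def) (rule sum.cong; auto)
    also have "\<dots> = f * Poly_Mapping.lookup X (a - b)"
      by (subst sum.delta) (auto simp: not_in_keys_iff_lookup_eq_zero)
    finally show ?thesis .
  qed
  show "Poly_Mapping.lookup (emb f * X) a = f * Poly_Mapping.lookup X a"
    "Poly_Mapping.lookup (lam * X) a = Poly_Mapping.lookup X (a - 1)"
    using single[of 0 f] single[of 1 1] by (simp_all add: emb_def lam_def)
qed

text \<open>Multiplication from the left acts on each column separately, so the coefficients of one
  column satisfy a closed recursion; at a fixed phase point it is a recursion between complex
  numbers.\<close>

lemma lookup_monodromy_lax1:
  fixes e :: "nat \<Rightarrow> 'n::finite" and x :: "'n phase"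
  defines "t \<equiv> \<lambda>k i j a. Poly_Mapping.lookup (monodromy lax1 e k $ i $ j) a x"
  shows "t 0 i j a = (if i = j \<and> a = 0 then 1 else 0)"
    and "t (Suc k) 1 j a = p_coord (e (Suc k)) x * t k 1 j a - t k 1 j (a - 1) - exp (- q_coord (e (Suc k)) x) * t k 2 j a"
    and "t (Suc k) 2 j a = exp (q_coord (e (Suc k)) x) * t k 1 j a"
  by (simp_all add: t_def mat_def lookup_one when_def matrix_matrix_mult_def sum_2 lax1_def lookup_add lookup_minus
      lookup_emb_mult lookup_lam_mult expf_def algebra_simps)

text \<open>Entry (2,1) is carried along in the first induction because its top coefficient times
  exp(-q) of the new particle supplies the nearest-neighbour term of the Hamiltonian. The second
  column starts as (0, 1), so its induction begins after one factor; its entry (2,2) supplies the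
  term that closes the chain. The degree bounds make the remaining contributions vanish.\<close>

lemma toda_leading_coeffs:
  fixes e :: "nat \<Rightarrow> 'n::finite" and x :: "'n phase"
  defines "t \<equiv> \<lambda>k i j a. Poly_Mapping.lookup (monodromy lax1 e k $ i $ j) a x"
    and "P \<equiv> \<lambda>k. \<Sum>i=1..k. p_coord (e i) x"
  shows "(\<forall>a>int k. t k 1 1 a = 0) \<and> t k 1 1 (int k) = (-1) ^ k \<and> t k 1 1 (int k - 1) = - ((-1) ^ k) * P k \<and>
      t k 1 1 (int k - 2) = (-1) ^ k * ((P k)\<^sup>2 / 2 - toda_np e k x) \<and>
      (\<forall>a>int k - 1. t k 2 1 a = 0) \<and>
      t k 2 1 (int k - 1) = (if k = 0 then 0 else - ((-1) ^ k) * exp (q_coord (e k) x))" (is ?thesis1)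
    and "(\<forall>a>int k. t (Suc k) 1 2 a = 0) \<and> t (Suc k) 1 2 (int k) = - ((-1) ^ k) * exp (- q_coord (e 1) x) \<and>
      (\<forall>a>int k - 1. t (Suc k) 2 2 a = 0) \<and>
      t (Suc k) 2 2 (int k - 1) = (if k = 0 then 0 else (-1) ^ k * exp (q_coord (e (Suc k)) x - q_coord (e 1) x))" (is ?thesis2)
proof -
  have rec: "t 0 i j a = (if i = j \<and> a = 0 then 1 else 0)"
      "t (Suc k) 1 j a = p_coord (e (Suc k)) x * t k 1 j a - t k 1 j (a - 1) - exp (- q_coord (e (Suc k)) x) * t k 2 j a"
      "t (Suc k) 2 j a = exp (q_coord (e (Suc k)) x) * t k 1 j a" for i j k a
    unfolding t_def by (rule lookup_monodromy_lax1)+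
  have H: "toda_np e (Suc k) x = toda_np e k x + (p_coord (e (Suc k)) x)\<^sup>2 / 2 +
      (if k = 0 then 0 else exp (q_coord (e k) x) * exp (- q_coord (e (Suc k)) x))" for k
    by (cases k) (simp_all add: toda_np_def exp_add[symmetric] field_simps)
  show ?thesis1
  proof (induction k)
    case 0
    show ?case by (simp add: rec P_def toda_np_def)
  next
    case (Suc k)
    then show ?case
      by (auto simp: rec P_def H power2_eq_square algebra_simps add_divide_distrib)
  qed
  show ?thesis2
  proof (induction k)
    case 0
    show ?case by (simp add: rec)
  next
    case (Suc k)
    then show ?case
      by (auto simp: rec field_simps exp_minus exp_diff exp_add)
  qed
qed

section \<open>Quantum integrability of the Toda chains\<close>

lemma star_const_commute:
  assumes "f \<in> poly_exp" "g \<in> poly_exp" "qfun f * qfun g = qfun g * qfun f"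
  shows "fps_const f \<star> fps_const g = fps_const g \<star> fps_const f"
  using arg_cong[OF assms(3), of Rep_qobs] assms(1,2) by (simp add: times_qobs.rep_eq Rep_qfun)

text \<open>H is a star polynomial in two coefficients of X, because P is a multiple of one of them.
  So the classical coefficients, taken as constant series in \<hbar>, serve as the quantum conserved
  quantities. For n = 1 the coefficient with exponent n - 2 lies outside the list of conserved
  quantities, but commutation holds for all integer exponents.\<close>

lemma quantum_integrable_toda:
  fixes X :: "'n::finite laurent" and c :: complex
  assumes X: "X \<in> laurent_over (local_obs S)"
    and comm: "\<And>a b. qfun (Poly_Mapping.lookup X a) * qfun (Poly_Mapping.lookup X b) =
      qfun (Poly_Mapping.lookup X b) * qfun (Poly_Mapping.lookup X a)"
    and P: "P \<in> poly_exp" "\<And>j. dir_deriv (axis j 1, 0) P = 0"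
    and top: "Poly_Mapping.lookup X (int n - 1) = (\<lambda>_. - ((-1) ^ n)) * P"
    and H: "H = (\<lambda>_. 1 / 2) * (P * P) - (\<lambda>_. (-1) ^ n) * Poly_Mapping.lookup X (int n - 2) + (\<lambda>_. c)"
  shows "quantum_integrable n H (\<lambda>i. Poly_Mapping.lookup X (int i - 1))"
proof -
  let ?x = "\<lambda>a. Poly_Mapping.lookup X a"
  have pe: "?x a \<in> poly_exp" for a
    using X by (auto simp: laurent_over_def local_obs_def)
  have Hpe: "H \<in> poly_exp"
    unfolding H by (intro poly_exp.add poly_exp_diff poly_exp.mult poly_exp.const P pe)
  have "P = (\<lambda>_. - ((-1) ^ n)) * ?x (int n - 1)"
    unfolding top by (rule ext) (simp add: mult.assoc[symmetric] power_mult_distrib[symmetric])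
  then have "qfun P = qfun ((\<lambda>_. - ((-1) ^ n)) * ?x (int n - 1))"
    by (rule arg_cong)
  also have "\<dots> = qscale (fps_const (- ((-1) ^ n))) (qfun (?x (int n - 1)))"
    by (rule qfun_qscale[OF pe])
  finally have qP: "qfun P = \<dots>" .
  \<comment> \<open>P has no position derivatives, and every term of the Poisson operator takes
    one.\<close>
  have PP: "qfun (P * P) = qfun P * qfun P"
    by (rule qfun_mult[OF P(1) P(1), symmetric]) (simp add: P bivec_tensor fun_eq_iff sum_fun_apply)
  have qH: "qfun H = qscale (fps_const (1 / 2)) (qfun P * qfun P) -
      qscale (fps_const ((-1) ^ n)) (qfun (?x (int n - 2))) + qscale (fps_const c) 1"
    unfolding H PP[symmetric]
    by (simp only: qfun_add qfun_diff qfun_qscale qfun_const_qscale poly_exp.const poly_exp.mult poly_exp_diff P pe)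
  have xP: "qfun (?x a) * qfun P = qfun P * qfun (?x a)" for a
    unfolding qP qscale_simps(1,2) comm[of a] ..
  have xPP: "qfun (?x a) * (qfun P * qfun P) = qfun P * qfun P * qfun (?x a)" for a
  proof -
    have "qfun (?x a) * (qfun P * qfun P) = qfun P * qfun (?x a) * qfun P"
      by (simp only: mult.assoc[symmetric] xP)
    also have "\<dots> = qfun P * (qfun (?x a) * qfun P)"
      by (rule mult.assoc)
    also have "\<dots> = qfun P * qfun P * qfun (?x a)"
      by (simp only: xP mult.assoc)
    finally show ?thesis .
  qed
  have xH: "qfun (?x a) * qfun H = qfun H * qfun (?x a)" for a
    unfolding qH distrib_left distrib_right left_diff_distrib right_diff_distrib qscale_simps(1,2)
      xPP comm[of a "int n - 2"] by simp
  have 1: "fps_const (?x a) \<star> fps_const H = fps_const H \<star> fps_const (?x a)"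
    "fps_const (?x a) \<star> fps_const (?x b) = fps_const (?x b) \<star> fps_const (?x a)" for a b
    by (rule star_const_commute[OF pe Hpe xH] star_const_commute[OF pe pe comm])+
  \<comment> \<open>A constant series has the zero function as its coefficient in every positive
    order, and smoothness is demanded of these as well.\<close>
  have "smooth (0 :: 'n obs)"
    by (rule poly_exp_smooth) simp
  then have sm: "smooth_fps (fps_const (?x a))" for a
    by (simp add: smooth_fps_def poly_exp_smooth[OF pe])
  show ?thesis
    unfolding quantum_integrable_def
    by (rule exI[of _ "\<lambda>i. fps_const (?x (int i - 1))"]) (simp add: 1 sm)
qed

lemma toda_integrable:
  fixes e :: "nat \<Rightarrow> 'n::finite"
  assumes "1 \<le> n" "inj_on e {1..n}"
  shows "quantum_integrable n (toda_np e n) (\<lambda>i. Poly_Mapping.lookup (chi_tilde lax1 e n) (int i - 1))"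
    and "quantum_integrable n (toda_per e n) (\<lambda>i. Poly_Mapping.lookup (chi lax1 e n) (int i - 1))"
proof -
  let ?M = "monodromy lax1 e n" and ?P = "\<Sum>i=1..n. p_coord (e i) :: 'n obs"
  have chi: "chi lax1 e n = ?M $ 1 $ 1 + ?M $ 2 $ 2" "chi_tilde lax1 e n = ?M $ 1 $ 1"
    by (simp_all add: chi_def chi_tilde_def trace_def sum_2 matrix_matrix_mult_def)
  \<comment> \<open>The parameters of the other matrices are arbitrary here; zeros merely
    instantiate them.\<close>
  have "lax1 \<in> {lax1, lax2, lax3, lax4 0, lax5 0 0, lax6 0, lax7 0 :: 'n lax}"
    by simp
  note coeffs = chi_coeffs_commute[OF local_lax_cases[OF this] rtt_lax_cases[OF this] assms(2)]
  have P: "?P \<in> poly_exp"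
    by (rule poly_exp_sum) simp
  have dP: "dir_deriv (axis j 1, 0) ?P = 0" for j
    by (subst poly_exp_dir_deriv_sum) (simp_all add: dir_deriv_p_coord fun_eq_iff sum_fun_apply)
  have sq: "(-1) ^ n * ((-1) ^ n * c) = c" for c :: complex
    by (simp add: mult.assoc[symmetric] power_mult_distrib[symmetric])
  have A: "Poly_Mapping.lookup (?M $ 1 $ 1) (int n - 1) = (\<lambda>_. - ((-1) ^ n)) * ?P"
    and A': "Poly_Mapping.lookup (?M $ 1 $ 1) (int n - 2) = (\<lambda>_. (-1) ^ n) * ((\<lambda>_. 1 / 2) * (?P * ?P) - toda_np e n)"
    using toda_leading_coeffs(1)[of n e] by (auto simp: fun_eq_iff sum_fun_apply power2_eq_square)
  have D: "Poly_Mapping.lookup (?M $ 2 $ 2) (int n - 1) = 0"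
    and D': "Poly_Mapping.lookup (?M $ 2 $ 2) (int n - 2) =
      (if n = 1 then 0 else (\<lambda>x. - ((-1) ^ n) * exp (q_coord (e n) x - q_coord (e 1) x)))"
    using assms(1) toda_leading_coeffs(2)[of "n - 1" e] by (cases n; auto simp: fun_eq_iff)+
  show "quantum_integrable n (toda_np e n) (\<lambda>i. Poly_Mapping.lookup (chi_tilde lax1 e n) (int i - 1))"
    by (rule quantum_integrable_toda[OF coeffs P dP, where c = 0])
      (simp_all add: chi A A' fun_eq_iff sq right_diff_distrib)
  \<comment> \<open>For n = 1 the closing term is exp(0) = 1 while the entry (2,2) of the single
    factor is 0; the constant c makes up for the difference.\<close>
  show "quantum_integrable n (toda_per e n) (\<lambda>i. Poly_Mapping.lookup (chi lax1 e n) (int i - 1))"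
    by (rule quantum_integrable_toda[OF coeffs P dP, where c = "if n = 1 then 1 else 0"])
      (simp_all add: chi lookup_add A A' D D' toda_per_def fun_eq_iff sq algebra_simps)
qed

text \<open>The centralizer of f is closed under sums and star products and contains the scalars.
  Membership in the class is carried through the induction because associativity and distributivity
  depend on it.\<close>

lemma star_polynomials_commute:
  assumes "H \<in> star_polynomials A" "A \<subseteq> poly_exp"
    and "f \<in> poly_exp" "\<And>g. g \<in> A \<Longrightarrow> fps_const f \<star> fps_const g = fps_const g \<star> fps_const f"
  shows "H \<in> poly_exp_fps \<and> fps_const f \<star> H = H \<star> fps_const f"
  using assms(1)
proof induction
  case (generator g)
  then show ?case using assms(2,4) by auto
next
  case (scalar c)
  show ?case
    unfolding fps_scalar_def[symmetric] using assms(3)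
    by (simp add: star_scalar_left star_scalar_right mult.commute)
next
  case (add F G)
  then show ?case using assms(3) by (simp add: poly_exp_fps_add star_add_left star_add_right)
next
  case (star F G)
  then have FG: "F \<in> poly_exp_fps" "G \<in> poly_exp_fps" "fps_const f \<in> poly_exp_fps"
    using assms(3) by simp_all
  have "fps_const f \<star> (F \<star> G) = F \<star> fps_const f \<star> G"
    using star by (simp only: star_assoc[OF FG(3,1,2), symmetric])
  also have "\<dots> = F \<star> (G \<star> fps_const f)"
    using star by (simp only: star_assoc[OF FG(1,3,2)])
  also have "\<dots> = F \<star> G \<star> fps_const f"
    by (rule star_assoc[OF FG, symmetric])
  finally show ?case using star by (simp add: star_closed)
qed

section \<open>Laurent polynomials in two spectral parameters\<close>

lemma lookup_at_lambda: "Poly_Mapping.lookup (at_lambda X) (a, b) = (if b = 0 then fps_const (Poly_Mapping.lookup X a) else 0)"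
  and lookup_at_mu: "Poly_Mapping.lookup (at_mu X) (b, a) = (if b = 0 then fps_const (Poly_Mapping.lookup X a) else 0)"
proof -
  let ?f = "\<lambda>a. if b = 0 then fps_const (Poly_Mapping.lookup X a) else 0"
  have "(\<Sum>c\<in>Poly_Mapping.keys X. if c = a then ?f c else 0) = ?f a"
  proof (cases "a \<in> Poly_Mapping.keys X")
    case True
    then show ?thesis by (simp only: sum.delta[OF finite_keys] if_True)
  next
    case False
    then have "Poly_Mapping.lookup X a = 0"
      unfolding not_in_keys_iff_lookup_eq_zero .
    then show ?thesis
      by (simp only: sum.delta[OF finite_keys] False if_False fps_const_0_eq_0 if_cancel)
  qed
  moreover have "Poly_Mapping.lookup (at_lambda X) (a, b) = (\<Sum>c\<in>Poly_Mapping.keys X. if c = a then ?f c else 0)"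
    unfolding at_lambda_def lookup_sum by (rule sum.cong) (simp_all add: lookup_single when_def)
  moreover have "Poly_Mapping.lookup (at_mu X) (b, a) = (\<Sum>c\<in>Poly_Mapping.keys X. if c = a then ?f c else 0)"
    unfolding at_mu_def lookup_sum by (rule sum.cong) (simp_all add: lookup_single when_def)
  ultimately show "Poly_Mapping.lookup (at_lambda X) (a, b) = ?f a" "Poly_Mapping.lookup (at_mu X) (b, a) = ?f a"
    by simp_all
qed

lemma keys_at_lambda: "Poly_Mapping.keys (at_lambda X) = (\<lambda>a. (a, 0)) ` Poly_Mapping.keys X"
  and keys_at_mu: "Poly_Mapping.keys (at_mu X) = (\<lambda>a. (0, a)) ` Poly_Mapping.keys X"
proof -
  have 1: "(a, b) \<in> Poly_Mapping.keys (at_lambda X) \<longleftrightarrow> b = 0 \<and> a \<in> Poly_Mapping.keys X"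
    and 2: "(b, a) \<in> Poly_Mapping.keys (at_mu X) \<longleftrightarrow> b = 0 \<and> a \<in> Poly_Mapping.keys X" for a b
    unfolding in_keys_iff lookup_at_lambda lookup_at_mu
    by (cases "b = 0"; simp only: if_True if_False fps_const_eq_0_iff simp_thms)+
  show "Poly_Mapping.keys (at_lambda X) = (\<lambda>a. (a, 0)) ` Poly_Mapping.keys X"
    using 1 by (auto simp only: image_iff)
  show "Poly_Mapping.keys (at_mu X) = (\<lambda>a. (0, a)) ` Poly_Mapping.keys X"
    using 2 by (auto simp only: image_iff)
qed

text \<open>At exponent (a, b) the two products have the coefficients of index a and b
  star-multiplied in opposite orders; no two index pairs share an exponent, since the parameters are
  independent.\<close>

lemma star_laurent_commute:
  assumes "\<And>a b. fps_const (Poly_Mapping.lookup X a) \<star> fps_const (Poly_Mapping.lookup X b) =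
    fps_const (Poly_Mapping.lookup X b) \<star> fps_const (Poly_Mapping.lookup X a)"
  shows "at_lambda X \<star>\<^sub>L at_mu X = at_mu X \<star>\<^sub>L at_lambda X"
proof -
  have inj: "inj_on (\<lambda>a. (a, 0::int)) A" "inj_on (\<lambda>a. (0::int, a)) A" for A :: "int set"
    by (auto intro: inj_onI)
  have "at_lambda X \<star>\<^sub>L at_mu X = (\<Sum>a\<in>Poly_Mapping.keys X. \<Sum>b\<in>Poly_Mapping.keys X. Poly_Mapping.single (a, b)
      (fps_const (Poly_Mapping.lookup X a) \<star> fps_const (Poly_Mapping.lookup X b)))"
    by (simp add: star_laurent_def keys_at_lambda keys_at_mu lookup_at_lambda lookup_at_mu sum.reindex inj)
  also have "\<dots> = (\<Sum>b\<in>Poly_Mapping.keys X. \<Sum>a\<in>Poly_Mapping.keys X. Poly_Mapping.single (a, b)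
      (fps_const (Poly_Mapping.lookup X b) \<star> fps_const (Poly_Mapping.lookup X a)))"
    by (subst sum.swap) (simp only: assms)
  also have "\<dots> = at_mu X \<star>\<^sub>L at_lambda X"
    by (simp add: star_laurent_def keys_at_lambda keys_at_mu lookup_at_lambda lookup_at_mu sum.reindex inj)
  finally show ?thesis .
qed

theorem theorem4p6:
  fixes n :: nat and e :: "nat \<Rightarrow> 'n::finite"
  assumes "1 \<le> n" and "bij_betw e {1..n} UNIV"
  shows
    "(\<forall>g \<delta> \<epsilon> :: complex. \<forall>U \<in> {lax1, lax2, lax3, lax4 g, lax5 g \<delta>, lax6 \<epsilon>, lax7 \<epsilon>}.
        \<forall>X \<in> {chi U e n, chi_tilde U e n}.
          at_lambda X \<star>\<^sub>L at_mu X = at_mu X \<star>\<^sub>L at_lambda X \<and>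
          (\<forall>f \<in> coeffs_of X. \<forall>f' \<in> coeffs_of X.
             fps_const f \<star> fps_const f' = fps_const f' \<star> fps_const f) \<and>
          (\<forall>H \<in> star_polynomials (coeffs_of X). \<forall>f \<in> coeffs_of X.
             fps_const f \<star> H = H \<star> fps_const f)) \<and>
     quantum_integrable n (toda_np e n)
       (\<lambda>i. Poly_Mapping.lookup (chi_tilde lax1 e n) (int i - 1)) \<and>
     quantum_integrable n (toda_per e n)
       (\<lambda>i. Poly_Mapping.lookup (chi lax1 e n) (int i - 1))"
proof (intro conjI allI ballI)
  have inj: "inj_on e {1..n}"
    using assms(2) by (rule bij_betw_imp_inj_on)
  show "quantum_integrable n (toda_np e n) (\<lambda>i. Poly_Mapping.lookup (chi_tilde lax1 e n) (int i - 1))"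
    "quantum_integrable n (toda_per e n) (\<lambda>i. Poly_Mapping.lookup (chi lax1 e n) (int i - 1))"
    by (rule toda_integrable[OF assms(1) inj])+
  fix g \<delta> \<epsilon> :: complex and U :: "'n lax" and X :: "'n laurent"
  assume U: "U \<in> {lax1, lax2, lax3, lax4 g, lax5 g \<delta>, lax6 \<epsilon>, lax7 \<epsilon>}" and X: "X \<in> {chi U e n, chi_tilde U e n}"
  note coeffs = chi_coeffs_commute[OF local_lax_cases[OF U] rtt_lax_cases[OF U] inj X]
  have pe: "Poly_Mapping.lookup X a \<in> poly_exp" for a
    using coeffs(1) by (auto simp: laurent_over_def local_obs_def)
  note comm = star_const_commute[OF pe pe coeffs(2)]
  show "at_lambda X \<star>\<^sub>L at_mu X = at_mu X \<star>\<^sub>L at_lambda X"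
    using comm by (rule star_laurent_commute)
  show *: "fps_const f \<star> fps_const f' = fps_const f' \<star> fps_const f"
    if "f \<in> coeffs_of X" "f' \<in> coeffs_of X" for f f'
    using that comm by (auto simp: coeffs_of_def)
  have "coeffs_of X \<subseteq> poly_exp"
    using pe by (auto simp: coeffs_of_def)
  then show "fps_const f \<star> H = H \<star> fps_const f"
    if "H \<in> star_polynomials (coeffs_of X)" "f \<in> coeffs_of X" for f H
    using star_polynomials_commute[OF that(1)] * that(2) by blast
qed

end
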